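(* Let $E$ be a self-affine Moran set with Moran construction $\{(n_k,m_k,\mathcal{D}_k)\}_{k\ge1}$, and suppose $N^+=\sup\{n_k,m_k : k\ge 1\}<\infty$. Let $\mathbf{p}\in\mathcal{P}$ and let $\mu_{\mathbf{p}}$ be the associated self-affine Moran measure. Then $$\overline{\dim}_e\,\mu_{\mathbf{p}}=\limsup_{k\to\infty}\frac{H_k(\mathbf{p})}{\sum_{i=1}^k\log m_i},\qquad \underline{\dim}_e\,\mu_{\mathbf{p}}=\liminf_{k\to\infty}\frac{H_k(\mathbf{p})}{\sum_{i=1}^k\log m_i},$$ where $\overline{\dim}_e$ and $\underline{\dim}_e$ are the upper and lower entropy dimensions and $H_k(\mathbf{p})$ is the $k$th entropy.
   Context: Self-affine Moran set: for each integer $k\ge1$ let $n_k\ge2$, $m_k\ge2$ be integers and $\mathcal{D}_k\subset\{0,\dots,n_k-1\}\times\{0,\dots,m_k-1\}$ with $r_k=\operatorname{card}(\mathcal{D}_k)\ge2$. Put $T_k=\operatorname{diag}(n_k^{-1},m_k^{-1})$ and, for $w\in\mathcal{D}_k$, $\Phi_w(x)=T_k(x+w)$ on $\mathbb{R}^2$ (the level $k$ being understood). Let $\Sigma^k=\prod_{j=1}^k\mathcal{D}_j$, $\Sigma^\infty=\prod_{j=1}^\infty\mathcal{D}_j$. For $\mathbf{w}=w_1\cdots w_k\in\Sigma^k$ put $J_{\mathbf{w}}=\Phi_{w_1}\circ\cdots\circ\Phi_{w_k}([0,1]^2)$. The self-affine Moran set is $E=\bigcap_{k\ge1}\bigcup_{\mathbf{w}\in\Sigma^k}J_{\mathbf{w}}$.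 Equivalently $E=\Pi(\Sigma^\infty)$ with $\Pi(\mathbf{w})=\sum_{k\ge1}\operatorname{diag}\big(\prod_{h=1}^k n_h^{-1},\prod_{h=1}^k m_h^{-1}\big)w_k$. Measures: $\mathcal{P}=\prod_{k\ge1}\mathcal{P}_k$, where $\mathcal{P}_k$ is the set of probability vectors on $\mathcal{D}_k$. For $\mathbf{p}=(\mathbf{p}_k)_k\in\mathcal{P}$, $\mathbf{p}_k=(p_k(w))_{w\in\mathcal{D}_k}$, let $\nu_{\mathbf{p}}$ be the Borel probability (product) measure on $\Sigma^\infty$ giving the cylinder $[w_1\cdots w_k]$ (the set of all $\tau\in\Sigma^\infty$ beginning with $w_1\cdots w_k$) mass $p_1(w_1)\cdots p_k(w_k)$. The self-affine Moran measure is $\mu_{\mathbf{p}}(A)=\nu_{\mathbf{p}}(\Pi^{-1}A)$. For $w=(i,j)\in\mathcal{D}_k$ put $q_k(w)=q_k(j)=\sum_{i':(i',j)\in\mathcal{D}_k}p_k(i',j)$ and $\widehat{q}_k(w)=\widehat{q}_k(i)=\sum_{j':(i,j')\in\mathcal{D}_k}p_k(i,j')$. For each $k\ge1$ let $l=l(k)$ be the unique integer with $\frac1{n_1\cdots n_l}\le\frac1{m_1\cdots m_k}<\frac1{n_1\cdots n_{l-1}}$. The $k$th entropy is (with $0\log0=0$) $$H_k(\mathbf{p})=\begin{cases}-\sum_{i=1}^{l}\sum_{w\in\mathcal{D}_i}p_i(w)\log p_i(w)-\sum_{i=l+1}^{k}\sum_{w\in\mathcal{D}_i}p_i(w)\log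 q_i(w), & l\le k,\\ -\sum_{i=1}^{k}\sum_{w\in\mathcal{D}_i}p_i(w)\log p_i(w)-\sum_{i=k+1}^{l}\sum_{w\in\mathcal{D}_i}p_i(w)\log\widehat{q}_i(w), & l>k.\end{cases}$$ Entropy dimensions: for a finite Borel measure $\mu$ on $\mathbb{R}^2$ let $\mathcal{M}_n$ be the partition of $\mathbb{R}^2$ into the dyadic boxes $\prod_{i=1}^2[2^{-n}j_i,2^{-n}(j_i+1))$, $j_i\in\mathbb{Z}$, and $H_n(\mu)=-\sum_{Q\in\mathcal{M}_n}\mu(Q)\log\mu(Q)$. Then $\underline{\dim}_e\mu=\liminf_{n\to\infty}H_n(\mu)/\log 2^n$ and $\overline{\dim}_e\mu=\limsup_{n\to\infty}H_n(\mu)/\log2^n$. *)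

theory Defs
  imports "HOL-Probability.Probability"
begin

text \<open>
  Levels are the natural numbers \<open>k \<ge> 1\<close>; the values of all sequences at \<open>0\<close> are irrelevant.
  The plane is \<^typ>\<open>real \<times> real\<close>.
\<close>

section \<open>Self-affine Moran sets\<close>

definition moran_construction ::
    "(nat \<Rightarrow> nat) \<Rightarrow> (nat \<Rightarrow> nat) \<Rightarrow> (nat \<Rightarrow> (nat \<times> nat) set) \<Rightarrow> bool" where
  "moran_construction n m D \<longleftrightarrow>
     (\<forall>k\<ge>1. n k \<ge> 2 \<and> m k \<ge> 2 \<and> D k \<subseteq> {0..<n k} \<times> {0..<m k} \<and> card (D k) \<ge> 2)"

definition diag_map :: "real \<Rightarrow> real \<Rightarrow> real \<times> real \<Rightarrow> real \<times> real" where
  "diag_map a b x = (a * fst x, b * snd x)"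

definition vec_of :: "nat \<times> nat \<Rightarrow> real \<times> real" where
  "vec_of w = (real (fst w), real (snd w))"

definition moran_map ::
    "(nat \<Rightarrow> nat) \<Rightarrow> (nat \<Rightarrow> nat) \<Rightarrow> nat \<Rightarrow> nat \<times> nat \<Rightarrow> real \<times> real \<Rightarrow> real \<times> real" where
  "moran_map n m k w x = diag_map (1 / real (n k)) (1 / real (m k)) (x + vec_of w)"

definition words :: "(nat \<Rightarrow> (nat \<times> nat) set) \<Rightarrow> nat \<Rightarrow> (nat \<Rightarrow> nat \<times> nat) set" where
  "words D k = (\<Pi>\<^sub>E j\<in>{1..k}. D j)"

definition infinite_words :: "(nat \<Rightarrow> (nat \<times> nat) set) \<Rightarrow> (nat \<Rightarrow> nat \<times> nat) set" where
  "infinite_words D = (\<Pi>\<^sub>E j\<in>{1..}. D j)"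

primrec word_map ::
    "(nat \<Rightarrow> nat) \<Rightarrow> (nat \<Rightarrow> nat) \<Rightarrow> nat \<Rightarrow> (nat \<Rightarrow> nat \<times> nat) \<Rightarrow> real \<times> real \<Rightarrow> real \<times> real" where
  "word_map n m 0 w = id"
| "word_map n m (Suc k) w = word_map n m k w \<circ> moran_map n m (Suc k) (w (Suc k))"

definition moran_box ::
    "(nat \<Rightarrow> nat) \<Rightarrow> (nat \<Rightarrow> nat) \<Rightarrow> nat \<Rightarrow> (nat \<Rightarrow> nat \<times> nat) \<Rightarrow> (real \<times> real) set" where
  "moran_box n m k w = word_map n m k w ` ({0..1} \<times> {0..1})"

definition moran_set ::
    "(nat \<Rightarrow> nat) \<Rightarrow> (nat \<Rightarrow> nat) \<Rightarrow> (nat \<Rightarrow> (nat \<times> nat) set) \<Rightarrow> (real \<times> real) set" where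
  "moran_set n m D = (\<Inter>k\<in>{1..}. \<Union>w\<in>words D k. moran_box n m k w)"

text \<open>The coding map; the series is indexed from \<open>0\<close>, so its term \<open>k\<close> belongs to level \<open>k + 1\<close>.\<close>

definition coding_map ::
    "(nat \<Rightarrow> nat) \<Rightarrow> (nat \<Rightarrow> nat) \<Rightarrow> (nat \<Rightarrow> nat \<times> nat) \<Rightarrow> real \<times> real" where
  "coding_map n m w =
     (\<Sum>k. diag_map (\<Prod>h=1..Suc k. 1 / real (n h)) (\<Prod>h=1..Suc k. 1 / real (m h))
             (vec_of (w (Suc k))))"

section \<open>Self-affine Moran measures\<close>

text \<open>A vector on \<open>D k\<close> is a function on all pairs whose values outside \<open>D k\<close> are never used.\<close>

definition prob_vectors :: "'a set \<Rightarrow> ('a \<Rightarrow> real) set" where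
  "prob_vectors A = {p. (\<forall>w\<in>A. p w \<ge> 0) \<and> (\<Sum>w\<in>A. p w) = 1}"

definition prob_vector_seqs ::
    "(nat \<Rightarrow> (nat \<times> nat) set) \<Rightarrow> (nat \<Rightarrow> nat \<times> nat \<Rightarrow> real) set" where
  "prob_vector_seqs D = {p. \<forall>k\<ge>1. p k \<in> prob_vectors (D k)}"

definition word_measure ::
    "(nat \<Rightarrow> (nat \<times> nat) set) \<Rightarrow> (nat \<Rightarrow> nat \<times> nat \<Rightarrow> real) \<Rightarrow> (nat \<Rightarrow> nat \<times> nat) measure" where
  "word_measure D p = (\<Pi>\<^sub>M k\<in>{1..}. point_measure (D k) (\<lambda>w. ennreal (p k w)))"

definition moran_measure ::
    "(nat \<Rightarrow> nat) \<Rightarrow> (nat \<Rightarrow> nat) \<Rightarrow> (nat \<Rightarrow> (nat \<times> nat) set) \<Rightarrow> (nat \<Rightarrow> nat \<times> nat \<Rightarrow> real) \<Rightarrow>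
      (real \<times> real) measure" where
  "moran_measure n m D p = distr (word_measure D p) borel (coding_map n m)"

section \<open>The entropies of the construction\<close>

definition row_prob ::
    "(nat \<Rightarrow> (nat \<times> nat) set) \<Rightarrow> (nat \<Rightarrow> nat \<times> nat \<Rightarrow> real) \<Rightarrow> nat \<Rightarrow> nat \<times> nat \<Rightarrow> real" where
  "row_prob D p k w = (\<Sum>i | (i, snd w) \<in> D k. p k (i, snd w))"

definition column_prob ::
    "(nat \<Rightarrow> (nat \<times> nat) set) \<Rightarrow> (nat \<Rightarrow> nat \<times> nat \<Rightarrow> real) \<Rightarrow> nat \<Rightarrow> nat \<times> nat \<Rightarrow> real" where
  "column_prob D p k w = (\<Sum>j | (fst w, j) \<in> D k. p k (fst w, j))"

definition is_approx_level :: "(nat \<Rightarrow> nat) \<Rightarrow> (nat \<Rightarrow> nat) \<Rightarrow> nat \<Rightarrow> nat \<Rightarrow> bool" where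
  "is_approx_level n m k l \<longleftrightarrow> l \<ge> 1 \<and>
     1 / (\<Prod>h=1..l. real (n h)) \<le> 1 / (\<Prod>h=1..k. real (m h)) \<and>
     1 / (\<Prod>h=1..k. real (m h)) < 1 / (\<Prod>h=1..l-1. real (n h))"

definition approx_level :: "(nat \<Rightarrow> nat) \<Rightarrow> (nat \<Rightarrow> nat) \<Rightarrow> nat \<Rightarrow> nat" where
  "approx_level n m k = (THE l. is_approx_level n m k l)"

text \<open>The convention \<open>0 log 0 = 0\<close> is automatic, since \<open>ln\<close> is total and \<open>0 * x = 0\<close>.\<close>

definition moran_entropy ::
    "(nat \<Rightarrow> nat) \<Rightarrow> (nat \<Rightarrow> nat) \<Rightarrow> (nat \<Rightarrow> (nat \<times> nat) set) \<Rightarrow> (nat \<Rightarrow> nat \<times> nat \<Rightarrow> real) \<Rightarrow>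
      nat \<Rightarrow> real" where
  "moran_entropy n m D p k =
     (let l = approx_level n m k in
      if l \<le> k then
        - (\<Sum>i=1..l. \<Sum>w\<in>D i. p i w * ln (p i w))
        - (\<Sum>i=l+1..k. \<Sum>w\<in>D i. p i w * ln (row_prob D p i w))
      else
        - (\<Sum>i=1..k. \<Sum>w\<in>D i. p i w * ln (p i w))
        - (\<Sum>i=k+1..l. \<Sum>w\<in>D i. p i w * ln (column_prob D p i w)))"

section \<open>Entropy dimensions\<close>

definition dyadic_boxes :: "nat \<Rightarrow> (real \<times> real) set set" where
  "dyadic_boxes n =
     {{real_of_int i / 2 ^ n ..< (real_of_int i + 1) / 2 ^ n} \<times>
      {real_of_int j / 2 ^ n ..< (real_of_int j + 1) / 2 ^ n} | i j :: int. True}"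

text \<open>
  The sum runs over infinitely many boxes and may be infinite for an arbitrary finite measure,
  hence it is taken in \<^typ>\<open>ereal\<close>. It always exists there, because only finitely many of its
  terms are negative.
\<close>

definition dyadic_entropy :: "(real \<times> real) measure \<Rightarrow> nat \<Rightarrow> ereal" where
  "dyadic_entropy \<mu> n =
     (\<Sum>\<^sub>\<infinity>Q\<in>dyadic_boxes n. ereal (- (measure \<mu> Q * ln (measure \<mu> Q))))"

definition upper_entropy_dim :: "(real \<times> real) measure \<Rightarrow> ereal" where
  "upper_entropy_dim \<mu> = limsup (\<lambda>n. dyadic_entropy \<mu> n / ereal (ln (2 ^ n)))"

definition lower_entropy_dim :: "(real \<times> real) measure \<Rightarrow> ereal" where
  "lower_entropy_dim \<mu> = liminf (\<lambda>n. dyadic_entropy \<mu> n / ereal (ln (2 ^ n)))"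

section \<open>The definitions are meaningful\<close>

text \<open>
  The level \<open>approx_level n m k\<close> is uniquely determined, \<open>word_measure\<close> has the prescribed
  values on cylinders, and the coding map is a convergent series and is Borel measurable.
\<close>

lemma approx_level_ex1:
  assumes "moran_construction n m D" and "k \<ge> 1"
  shows "\<exists>!l. is_approx_level n m k l"
proof -
  define N where "N l = (\<Prod>h=1..l. real (n h))" for l
  define M where "M = (\<Prod>h=1..k. real (m h))"
  have n2: "real (n h) \<ge> 2" and m2: "real (m h) \<ge> 2" if "h \<ge> 1" for h
    using assms(1) that by (auto simp: moran_construction_def)
  have Npos: "N l > 0" for l
    unfolding N_def by (rule prod_pos) (use n2 in fastforce)
  have NS: "N (Suc l) \<ge> 2 * N l" for l
    using n2[of "Suc l"] Npos[of l] by (simp add: N_def)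
  have Nlt: "N l < N (Suc l)" for l using NS[of l] Npos[of l] by linarith
  have sm: "strict_mono N" by (rule strict_monoI_Suc) (rule Nlt)
  have Ngr: "N l \<ge> 2 ^ l" for l
  proof (induction l)
    case 0 then show ?case by (simp add: N_def)
  next
    case (Suc l) then show ?case using NS[of l] by simp
  qed
  have M1: "M > 1"
    unfolding M_def by (rule less_1_prod) (use m2 assms(2) in fastforce)+
  have iff: "is_approx_level n m k l \<longleftrightarrow> l \<ge> 1 \<and> M \<le> N l \<and> N (l - 1) < M" for l
  proof -
    have "1 / N l \<le> 1 / M \<longleftrightarrow> M \<le> N l" "1 / M < 1 / N (l - 1) \<longleftrightarrow> N (l - 1) < M"
      using Npos[of l] Npos[of "l - 1"] M1 by (auto simp: field_simps)
    then show ?thesis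
      unfolding is_approx_level_def N_def[symmetric] M_def[symmetric] by simp
  qed
  have ex: "\<exists>l. M \<le> N l"
  proof -
    obtain l where "M < 2 ^ l" using real_arch_pow[of 2 M] by auto
    then show ?thesis using Ngr[of l] by (intro exI[of _ l]) linarith
  qed
  define L where "L = (LEAST l. M \<le> N l)"
  have L: "M \<le> N L" unfolding L_def using ex by (rule LeastI_ex)
  have "N 0 = 1" by (simp add: N_def)
  with L M1 have L1: "L \<ge> 1" by (cases L) auto
  have "N (L - 1) < M" using L1 not_less_Least[of "L - 1" "\<lambda>l. M \<le> N l"]
    unfolding L_def[symmetric] by auto
  with L L1 have a: "is_approx_level n m k L" unfolding iff by blast
  moreover have "l = L" if "is_approx_level n m k l" for l
  proof (rule ccontr)
    assume "l \<noteq> L"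
    then consider "l \<le> L - 1" | "L \<le> l - 1" using L1 that[unfolded iff] by linarith
    then show False
      using that a unfolding iff using strict_mono_mono[OF sm, THEN monoD, of l "L - 1"]
        strict_mono_mono[OF sm, THEN monoD, of L "l - 1"] by cases auto
  qed
  ultimately show ?thesis by blast
qed

lemma moran_construction_finite: "moran_construction n m D \<Longrightarrow> k \<ge> 1 \<Longrightarrow> finite (D k)"
  by (rule card_ge_0_finite) (force simp: moran_construction_def)

lemma prob_space_level:
  assumes "moran_construction n m D" "p \<in> prob_vector_seqs D" "k \<ge> 1"
  shows "prob_space (point_measure (D k) (\<lambda>w. ennreal (p k w)))"
proof (rule prob_spaceI)
  have f: "finite (D k)" using moran_construction_finite[OF assms(1,3)] .
  have p: "\<And>w. w \<in> D k \<Longrightarrow> p k w \<ge> 0" "(\<Sum>w\<in>D k. p k w) = 1"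
    using assms by (auto simp: prob_vector_seqs_def prob_vectors_def)
  show "emeasure (point_measure (D k) (\<lambda>w. ennreal (p k w))) (space (point_measure (D k) (\<lambda>w. ennreal (p k w)))) = 1"
    using f p by (simp add: emeasure_point_measure_finite space_point_measure sum_ennreal)
qed

lemma space_word_measure: "space (word_measure D p) = infinite_words D"
  by (simp add: word_measure_def infinite_words_def space_PiM space_point_measure)

lemma word_measure_cylinder:
  assumes c: "moran_construction n m D" and p: "p \<in> prob_vector_seqs D" and w: "w \<in> words D k"
  shows "emeasure (word_measure D p) {\<tau>\<in>infinite_words D. \<forall>j\<in>{1..k}. \<tau> j = w j}
           = ennreal (\<Prod>j=1..k. p j (w j))"
proof -
  let ?M = "\<lambda>k. point_measure (D k) (\<lambda>w. ennreal (p k w))"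
  have wD: "\<And>j. j \<in> {1..k} \<Longrightarrow> w j \<in> D j" using w by (auto simp: words_def)
  have "{\<tau>\<in>infinite_words D. \<forall>j\<in>{1..k}. \<tau> j = w j}
      = prod_emb {1..} ?M {1..k} (\<Pi>\<^sub>E j\<in>{1..k}. {w j})"
    by (auto simp: prod_emb_def infinite_words_def space_point_measure PiE_iff restrict_def
      extensional_def)
  then have "emeasure (word_measure D p) {\<tau>\<in>infinite_words D. \<forall>j\<in>{1..k}. \<tau> j = w j}
      = (\<Prod>j\<in>{1..k}. emeasure (?M j) {w j})"
    unfolding word_measure_def
    by (simp only:) (rule emeasure_PiM_emb,
        use prob_space_level[OF c p] wD in \<open>auto simp: sets_point_measure\<close>)
  also have "\<dots> = (\<Prod>j\<in>{1..k}. ennreal (p j (w j)))"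
    by (rule prod.cong) (use wD moran_construction_finite[OF c] in \<open>auto simp: emeasure_point_measure_finite\<close>)
  also have "\<dots> = ennreal (\<Prod>j=1..k. p j (w j))"
    by (rule prod_ennreal) (use p wD in \<open>auto simp: prob_vector_seqs_def prob_vectors_def\<close>)
  finally show ?thesis .
qed

lemma coding_map_summable:
  assumes c: "moran_construction n m D" and w: "w \<in> infinite_words D"
  shows "summable (\<lambda>k. diag_map (\<Prod>h=1..Suc k. 1 / real (n h)) (\<Prod>h=1..Suc k. 1 / real (m h))
             (vec_of (w (Suc k))))"
proof (rule summable_comparison_test')
  show "summable (\<lambda>k. 2 * (1/2::real) ^ k)" by (intro summable_mult summable_geometric) auto
next
  have n2: "real (n h) \<ge> 2" "real (m h) \<ge> 2" if "h \<ge> 1" for h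
    using c that by (auto simp: moran_construction_def)
  have half: "(\<Prod>h=1..k. 1 / real (f h)) \<le> (1/2) ^ k" "(\<Prod>h=1..k. 1 / real (f h)) \<ge> 0"
    if "\<And>h. h \<ge> 1 \<Longrightarrow> real (f h) \<ge> 2" for k and f :: "nat \<Rightarrow> nat"
  proof -
    show "(\<Prod>h=1..k. 1 / real (f h)) \<ge> 0" by (simp add: prod_nonneg)
    have "(\<Prod>h=1..k. 1 / real (f h)) \<le> (\<Prod>h=1..k. 1/2)"
    proof (rule prod_mono)
      fix i assume "i \<in> {1..k}"
      then show "0 \<le> 1 / real (f i) \<and> 1 / real (f i) \<le> 1/2"
        using that[of i] by (auto intro!: divide_left_mono[of 2 "real (f i)" 1, simplified])
    qed
    then show "(\<Prod>h=1..k. 1 / real (f h)) \<le> (1/2) ^ k" by simp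
  qed
  have trm: "(\<Prod>h=1..Suc k. 1 / real (f h)) * real d \<le> (1/2)^k"
    "(\<Prod>h=1..Suc k. 1 / real (f h)) * real d \<ge> 0"
    if f: "\<And>h. h \<ge> 1 \<Longrightarrow> real (f h) \<ge> 2" and d: "d < f (Suc k)" for k d and f :: "nat \<Rightarrow> nat"
  proof -
    have "1 / real (f (Suc k)) * real d \<le> 1" using d by (simp add: field_simps)
    have "(\<Prod>h=1..Suc k. 1 / real (f h)) * real d
        = (\<Prod>h=1..k. 1 / real (f h)) * (1 / real (f (Suc k)) * real d)" by simp
    also have "\<dots> \<le> (1/2)^k * 1"
      by (rule mult_mono) (use half[of f k, OF f] d in \<open>auto simp: field_simps\<close>)
    finally show "(\<Prod>h=1..Suc k. 1 / real (f h)) * real d \<le> (1/2)^k" by simp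
    show "(\<Prod>h=1..Suc k. 1 / real (f h)) * real d \<ge> 0" by (intro mult_nonneg_nonneg half f) auto
  qed
  fix k :: nat
  have "w (Suc k) \<in> D (Suc k)" using w by (auto simp: infinite_words_def PiE_iff)
  then have lt: "fst (w (Suc k)) < n (Suc k)" "snd (w (Suc k)) < m (Suc k)"
    using c by (auto simp: moran_construction_def dest!: spec[of _ "Suc k"])
  let ?a = "(\<Prod>h=1..Suc k. 1 / real (n h)) * real (fst (w (Suc k)))"
  let ?b = "(\<Prod>h=1..Suc k. 1 / real (m h)) * real (snd (w (Suc k)))"
  have "norm (?a, ?b) \<le> norm ?a + norm ?b" by (rule norm_Pair_le)
  also have "\<dots> \<le> 2 * (1/2)^k"
    using trm[of n "fst (w (Suc k))" k, OF n2(1) lt(1)] trm[of m "snd (w (Suc k))" k, OF n2(2) lt(2)]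
    unfolding real_norm_def by linarith
  finally show "norm (diag_map (\<Prod>h=1..Suc k. 1 / real (n h)) (\<Prod>h=1..Suc k. 1 / real (m h))
             (vec_of (w (Suc k)))) \<le> 2 * (1/2)^k"
    unfolding diag_map_def vec_of_def fst_conv snd_conv .
qed

lemma coding_map_measurable:
  assumes c: "moran_construction n m D"
  shows "coding_map n m \<in> borel_measurable (word_measure D p)"
proof (rule borel_measurable_LIMSEQ_metric)
  fix N
  have "(\<lambda>w. w (Suc k)) \<in> word_measure D p \<rightarrow>\<^sub>M point_measure (D (Suc k)) (\<lambda>w. ennreal (p (Suc k) w))" for k
    unfolding word_measure_def by (rule measurable_component_singleton) auto
  then have *: "(\<lambda>w. g (w (Suc k))) \<in> borel_measurable (word_measure D p)" for k
    and g :: "_ \<Rightarrow> real \<times> real"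
    by (rule measurable_compose) simp
  show "(\<lambda>w. \<Sum>k<N. diag_map (\<Prod>h=1..Suc k. 1 / real (n h)) (\<Prod>h=1..Suc k. 1 / real (m h))
             (vec_of (w (Suc k)))) \<in> borel_measurable (word_measure D p)"
    by (intro borel_measurable_sum *)
next
  fix w assume "w \<in> space (word_measure D p)"
  then show "(\<lambda>N. \<Sum>k<N. diag_map (\<Prod>h=1..Suc k. 1 / real (n h)) (\<Prod>h=1..Suc k. 1 / real (m h))
             (vec_of (w (Suc k)))) \<longlonglongrightarrow> coding_map n m w"
    unfolding coding_map_def space_word_measure
    by (intro summable_LIMSEQ coding_map_summable[OF c])
qed

end

theory Submission
  imports Defs
begin

text \<open>
  On the coding space, the approximate squares of level \<open>k\<close> (words sharing the first \<open>l(k)\<close>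
  horizontal and the first \<open>k\<close> vertical digits) form a partition whose Shannon entropy is exactly
  the \<open>k\<close>th entropy, because the digits of different levels are independent. If \<open>2\<^sup>t\<close> is comparable to
  \<open>m\<^sub>1 \<cdots> m\<^sub>k\<close>, an approximate square of level \<open>k\<close> meets boundedly many dyadic boxes of side
  \<open>2\<^sup>-\<^sup>t\<close> and vice versa, so by Gibbs' inequality the two entropies differ by a constant. As the
  bases are bounded, every \<open>k\<close> has a comparable \<open>t\<close> and conversely, and the two
  normalised entropies have the same upper and lower limits.
\<close>

section \<open>Entropy of partitions\<close>

definition partition_entropy :: "'a measure \<Rightarrow> ('a \<Rightarrow> 'b) \<Rightarrow> 'b set \<Rightarrow> real" where
  "partition_entropy M Y A =
     - (\<Sum>a\<in>A. measure M (Y -` {a} \<inter> space M) * ln (measure M (Y -` {a} \<inter> space M)))"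

text \<open>Gibbs' inequality, comparing \<open>P y z\<close> with \<open>s z / C\<close> on the
  support of \<open>P\<close>: for each \<open>z\<close> at most \<open>C\<close> values of
  \<open>y\<close> receive the weight \<open>s z / C\<close>, so the comparison weights add up to at
  most 1.\<close>

lemma marginal_entropy_le:
  fixes P :: "'a \<Rightarrow> 'b \<Rightarrow> real" and A :: "'a set" and B :: "'b set" and C :: nat
  defines "r \<equiv> \<lambda>y. \<Sum>z\<in>B. P y z" and "s \<equiv> \<lambda>z. \<Sum>y\<in>A. P y z"
  assumes fin: "finite A" "finite B"
    and nonneg: "\<And>y z. y \<in> A \<Longrightarrow> z \<in> B \<Longrightarrow> P y z \<ge> 0"
    and total: "(\<Sum>y\<in>A. \<Sum>z\<in>B. P y z) = 1"
    and C: "C > 0" "\<And>z. z \<in> B \<Longrightarrow> card {y\<in>A. P y z \<noteq> 0} \<le> C"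
  shows "- (\<Sum>y\<in>A. r y * ln (r y)) \<le> - (\<Sum>z\<in>B. s z * ln (s z)) + ln (real C)"
proof -
  have le_r: "P y z \<le> r y" if "y \<in> A" "z \<in> B" for y z
    unfolding r_def by (rule member_le_sum) (use that fin nonneg in auto)
  have le_s: "P y z \<le> s z" if "y \<in> A" "z \<in> B" for y z
    unfolding s_def by (rule member_le_sum[where f = "\<lambda>y. P y z"]) (use that fin nonneg in auto)
  have s0: "s z \<ge> 0" if "z \<in> B" for z
    unfolding s_def using nonneg that by (auto intro: sum_nonneg)
  have termwise: "P y z * (ln (s z) - ln (r y) - ln C)
      \<le> (if P y z \<noteq> 0 then s z / C else 0) - P y z" if yz: "y \<in> A" "z \<in> B" for y z
  proof (cases "P y z = 0")
    case False
    then have P: "P y z > 0" using nonneg[OF yz] by linarith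
    then have pos: "r y > 0" "s z > 0" using le_r[OF yz] le_s[OF yz] by linarith+
    have "ln (s z) - ln (r y) - ln C = ln (s z / (r y * C))"
      using pos C(1) by (simp add: ln_div ln_mult)
    also have "\<dots> \<le> s z / (r y * C) - 1"
      using pos C(1) by (intro ln_le_minus_one) simp
    finally have "P y z * (ln (s z) - ln (r y) - ln C) \<le> P y z * (s z / (r y * C) - 1)"
      using P by (intro mult_left_mono) auto
    also have "\<dots> = (P y z / r y) * (s z / C) - P y z"
      by (simp add: field_simps)
    \<comment> \<open>The factor \<open>P y z / r y\<close> is a conditional probability, hence at
      most 1; the resulting bound no longer involves \<open>r\<close>.\<close>
    also have "\<dots> \<le> 1 * (s z / C) - P y z"
      using le_r[OF yz] pos by (intro diff_right_mono mult_right_mono) auto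
    finally show ?thesis using False by simp
  qed simp
  have "(\<Sum>z\<in>B. s z * ln (s z)) - (\<Sum>y\<in>A. r y * ln (r y)) - ln C
      = (\<Sum>y\<in>A. \<Sum>z\<in>B. P y z * (ln (s z) - ln (r y) - ln C))"
  proof -
    have "(\<Sum>z\<in>B. s z * ln (s z)) = (\<Sum>y\<in>A. \<Sum>z\<in>B. P y z * ln (s z))"
      unfolding s_def sum_distrib_right by (rule sum.swap)
    moreover have "(\<Sum>y\<in>A. r y * ln (r y)) = (\<Sum>y\<in>A. \<Sum>z\<in>B. P y z * ln (r y))"
      unfolding r_def sum_distrib_right ..
    moreover have "ln C = (\<Sum>y\<in>A. \<Sum>z\<in>B. P y z * ln C)"
      using total by (simp add: sum_distrib_right[symmetric])
    ultimately show ?thesis by (simp add: right_diff_distrib sum_subtractf)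
  qed
  also have "\<dots> \<le> (\<Sum>y\<in>A. \<Sum>z\<in>B. (if P y z \<noteq> 0 then s z / C else 0) - P y z)"
    by (intro sum_mono termwise)
  also have "\<dots> = (\<Sum>z\<in>B. \<Sum>y\<in>A. if P y z \<noteq> 0 then s z / C else 0) - 1"
    by (simp add: sum_subtractf total, rule sum.swap)
  also have "\<dots> = (\<Sum>z\<in>B. card {y\<in>A. P y z \<noteq> 0} * (s z / C)) - 1"
    using fin by (simp add: sum.If_cases Int_def)
  also have "\<dots> \<le> (\<Sum>z\<in>B. C * (s z / C)) - 1"
    using C s0 by (intro diff_right_mono sum_mono mult_right_mono) auto
  also have "\<dots> = 0"
  proof -
    have "(\<Sum>z\<in>B. s z) = 1" unfolding s_def using total by (subst sum.swap)
    then show ?thesis using C(1) by simp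
  qed
  finally show ?thesis by linarith
qed

text \<open>The joint law of \<open>Y\<close> and \<open>Z\<close> fits
  \<open>marginal_entropy_le\<close>: a pair of positive probability is attained by some outcome, so
  \<open>y\<close> lies in the image of the fibre over \<open>z\<close>.\<close>

lemma (in prob_space) partition_entropy_le:
  fixes C :: nat
  assumes fin: "finite A" "finite B"
    and range: "\<And>\<omega>. \<omega> \<in> space M \<Longrightarrow> Y \<omega> \<in> A" "\<And>\<omega>. \<omega> \<in> space M \<Longrightarrow> Z \<omega> \<in> B"
    and events: "\<And>y. y \<in> A \<Longrightarrow> Y -` {y} \<inter> space M \<in> events"
      "\<And>z. z \<in> B \<Longrightarrow> Z -` {z} \<inter> space M \<in> events"
    and C: "\<And>z. z \<in> B \<Longrightarrow> card (Y ` (Z -` {z} \<inter> space M)) \<le> C"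
  shows "partition_entropy M Y A \<le> partition_entropy M Z B + ln (real C)"
proof -
  define S where "S y z = (Y -` {y} \<inter> space M) \<inter> (Z -` {z} \<inter> space M)" for y z
  have S: "S y z \<in> events" if "y \<in> A" "z \<in> B" for y z
    unfolding S_def using events that by auto
  have Y: "prob (Y -` {y} \<inter> space M) = (\<Sum>z\<in>B. prob (S y z))" if "y \<in> A" for y
    by (subst finite_measure_finite_Union[symmetric])
      (use fin S that range(2) in \<open>auto simp: S_def disjoint_family_on_def intro!: arg_cong[of _ _ prob]\<close>)
  have Z: "prob (Z -` {z} \<inter> space M) = (\<Sum>y\<in>A. prob (S y z))" if "z \<in> B" for z
    by (subst finite_measure_finite_Union[symmetric])
      (use fin S that range(1) in \<open>auto simp: S_def disjoint_family_on_def intro!: arg_cong[of _ _ prob]\<close>)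
  have "(\<Sum>y\<in>A. prob (Y -` {y} \<inter> space M)) = prob (space M)"
    by (subst finite_measure_finite_Union[symmetric])
      (use fin events range(1) in \<open>auto simp: disjoint_family_on_def intro!: arg_cong[of _ _ prob]\<close>)
  then have total: "(\<Sum>y\<in>A. \<Sum>z\<in>B. prob (S y z)) = 1"
    using Y by (simp add: prob_space)
  have sub: "{y\<in>A. prob (S y z) \<noteq> 0} \<subseteq> Y ` (Z -` {z} \<inter> space M)" for z
  proof
    fix y assume "y \<in> {y\<in>A. prob (S y z) \<noteq> 0}"
    then have "S y z \<noteq> {}" by auto
    then show "y \<in> Y ` (Z -` {z} \<inter> space M)" by (auto simp: S_def)
  qed
  have img: "finite (Y ` (Z -` {z} \<inter> space M))" for z
    by (rule finite_subset[OF _ fin(1)]) (use range in auto)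
  have card: "card {y\<in>A. prob (S y z) \<noteq> 0} \<le> C" if "z \<in> B" for z
    using card_mono[OF img sub, of z] C[OF that] by linarith
  \<comment> \<open>Some fibre is nonempty, which forces \<open>C\<close> to be positive.\<close>
  obtain \<omega> where \<omega>: "\<omega> \<in> space M" using not_empty by auto
  then have "card (Y ` (Z -` {Z \<omega>} \<inter> space M)) > 0"
    using img by (subst card_gt_0_iff) auto
  with C range(2) \<omega> have "C > 0" using less_le_trans by blast
  from marginal_entropy_le[OF fin _ total this card] show ?thesis
    unfolding partition_entropy_def by (simp add: Y Z)
qed

lemma (in prob_space) partition_entropy_nonneg: "partition_entropy M Y A \<ge> 0"
proof -
  have "prob S * ln (prob S) \<le> 0" for S
    by (cases "prob S = 0")
      (use measure_nonneg[of M S] in \<open>auto intro!: mult_nonneg_nonpos simp: less_le\<close>)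
  then show ?thesis unfolding partition_entropy_def by (simp add: sum_nonpos)
qed

text \<open>Comparison with the partition into a single block, whose entropy is 0.\<close>

lemma (in prob_space) partition_entropy_le_ln_card:
  assumes "finite A" "\<And>\<omega>. \<omega> \<in> space M \<Longrightarrow> Y \<omega> \<in> A"
    "\<And>y. y \<in> A \<Longrightarrow> Y -` {y} \<inter> space M \<in> events"
  shows "partition_entropy M Y A \<le> ln (card A)"
proof -
  have "partition_entropy M Y A \<le> partition_entropy M (\<lambda>_. ()) {()} + ln (card A)"
    by (rule partition_entropy_le) (use assms in \<open>auto intro!: card_mono\<close>)
  also have "partition_entropy M (\<lambda>_. ()) {()} = 0"
    by (simp add: partition_entropy_def prob_space)
  finally show ?thesis by simp
qed

text \<open>Absorbing \<open>f (y j)\<close> into the \<open>j\<close>th weight splits the sum over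
  the product set into a product of sums, in which all other factors equal 1. This integrates out
  the remaining coordinates.\<close>

lemma sum_PiE_prod_mult:
  fixes r :: "'i \<Rightarrow> 'a \<Rightarrow> real"
  assumes I: "finite I" "j \<in> I" and fin: "\<And>i. i \<in> I \<Longrightarrow> finite (A i)"
    and one: "\<And>i. i \<in> I \<Longrightarrow> (\<Sum>a\<in>A i. r i a) = 1"
  shows "(\<Sum>y\<in>Pi\<^sub>E I A. (\<Prod>i\<in>I. r i (y i)) * f (y j)) = (\<Sum>a\<in>A j. r j a * f a)"
proof -
  let ?f = "\<lambda>i a. if i = j then r i a * f a else r i a"
  have "(\<Prod>i\<in>I. r i (y i)) * f (y j) = (\<Prod>i\<in>I. ?f i (y i))" for y
  proof -
    have "(\<Prod>i\<in>I - {j}. r i (y i)) = (\<Prod>i\<in>I - {j}. ?f i (y i))" by (rule prod.cong) auto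
    then show ?thesis
      using prod.remove[OF I, of "\<lambda>i. r i (y i)"] prod.remove[OF I, of "\<lambda>i. ?f i (y i)"] by simp
  qed
  then have "(\<Sum>y\<in>Pi\<^sub>E I A. (\<Prod>i\<in>I. r i (y i)) * f (y j)) = (\<Prod>i\<in>I. \<Sum>a\<in>A i. ?f i a)"
    using I fin by (simp add: prod_sum_PiE)
  also have "\<dots> = (\<Sum>a\<in>A j. r j a * f a) * (\<Prod>i\<in>I - {j}. 1)"
    by (subst prod.remove[OF I]) (use one in \<open>auto intro!: prod.cong\<close>)
  finally show ?thesis by simp
qed

text \<open>Additivity of entropy over independent coordinates: the logarithm of the product is a
  sum of terms in one coordinate each, to which \<open>sum_PiE_prod_mult\<close> applies.\<close>

lemma entropy_PiE_prod:
  fixes r :: "'i \<Rightarrow> 'a \<Rightarrow> real"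
  assumes I: "finite I" and fin: "\<And>i. i \<in> I \<Longrightarrow> finite (A i)"
    and nonneg: "\<And>i a. i \<in> I \<Longrightarrow> a \<in> A i \<Longrightarrow> r i a \<ge> 0"
    and one: "\<And>i. i \<in> I \<Longrightarrow> (\<Sum>a\<in>A i. r i a) = 1"
  shows "(\<Sum>y\<in>Pi\<^sub>E I A. (\<Prod>i\<in>I. r i (y i)) * ln (\<Prod>i\<in>I. r i (y i)))
    = (\<Sum>i\<in>I. \<Sum>a\<in>A i. r i a * ln (r i a))"
proof -
  have "(\<Prod>i\<in>I. r i (y i)) * ln (\<Prod>i\<in>I. r i (y i)) =
      (\<Sum>j\<in>I. (\<Prod>i\<in>I. r i (y i)) * ln (r j (y j)))" if y: "y \<in> Pi\<^sub>E I A" for y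
  \<comment> \<open>If the product vanishes, it kills both sides, whatever the logarithms are;
    otherwise every weight is positive.\<close>
  proof (cases "(\<Prod>i\<in>I. r i (y i)) = 0")
    case False
    then have "r i (y i) > 0" if "i \<in> I" for i
      using nonneg[OF that] y that I by (auto simp: less_le PiE_iff)
    then have "ln (\<Prod>i\<in>I. r i (y i)) = (\<Sum>j\<in>I. ln (r j (y j)))"
      using I by (intro ln_prod) (auto dest: less_imp_neq[symmetric])
    then show ?thesis by (simp add: sum_distrib_left)
  qed simp
  then have "(\<Sum>y\<in>Pi\<^sub>E I A. (\<Prod>i\<in>I. r i (y i)) * ln (\<Prod>i\<in>I. r i (y i)))
      = (\<Sum>j\<in>I. \<Sum>y\<in>Pi\<^sub>E I A. (\<Prod>i\<in>I. r i (y i)) * ln (r j (y j)))"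
    by (subst sum.swap) (rule sum.cong, auto)
  also have "\<dots> = (\<Sum>i\<in>I. \<Sum>a\<in>A i. r i a * ln (r i a))"
    by (intro sum.cong refl sum_PiE_prod_mult) (use I fin one in auto)
  finally show ?thesis .
qed

section \<open>Mixed radix expansions\<close>

text \<open>Horner form of the numerator of the truncated expansion: divided by the product of the
  first \<open>k\<close> bases it is a partial sum of the digit series, and as an integer it numbers
  the cell of level \<open>k\<close>.\<close>

primrec radix_value :: "(nat \<Rightarrow> nat) \<Rightarrow> (nat \<Rightarrow> nat) \<Rightarrow> nat \<Rightarrow> nat" where
  "radix_value b d 0 = 0"
| "radix_value b d (Suc k) = b (Suc k) * radix_value b d k + d (Suc k)"

lemma radix_value_cong:
  "(\<And>h. h \<in> {1..k} \<Longrightarrow> d h = e h) \<Longrightarrow> radix_value b d k = radix_value b e k"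
  by (induction k) auto

text \<open>Reduction modulo the last base recovers the last digit; the others follow by
  induction.\<close>

lemma radix_value_inject:
  assumes "radix_value b d k = radix_value b e k"
    and "\<And>h. h \<in> {1..k} \<Longrightarrow> d h < b h" "\<And>h. h \<in> {1..k} \<Longrightarrow> e h < b h"
    and "h \<in> {1..k}"
  shows "d h = e h"
  using assms
proof (induction k)
  case (Suc k)
  have lt: "d (Suc k) < b (Suc k)" "e (Suc k) < b (Suc k)" using Suc.prems(2,3) by auto
  have eq: "b (Suc k) * radix_value b d k + d (Suc k) = b (Suc k) * radix_value b e k + e (Suc k)"
    using Suc.prems(1) by simp
  from arg_cong[OF eq, of "\<lambda>x. x mod b (Suc k)"] have de: "d (Suc k) = e (Suc k)" using lt by simp
  with eq lt have "radix_value b d k = radix_value b e k" by auto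
  with Suc de show ?case by (cases "h = Suc k") auto
qed simp

text \<open>The partial sums \<open>S k\<close> never decrease and \<open>S k + 1 / N k\<close>
  never increases, so the value of the series lies between them. The upper bound is not strict: with
  bases at least 2, digits that are maximal from some level on attain it.\<close>

lemma radix_value_bounds:
  fixes b d :: "nat \<Rightarrow> nat"
  defines "t \<equiv> \<lambda>k. (\<Prod>h=1..Suc k. 1 / real (b h)) * real (d (Suc k))"
  assumes d: "\<And>h. h \<ge> 1 \<Longrightarrow> d h < b h" and sum: "summable t"
  shows "radix_value b d k \<le> (\<Prod>h=1..k. real (b h)) * suminf t"
    and "(\<Prod>h=1..k. real (b h)) * suminf t \<le> radix_value b d k + 1"
proof -
  define N where "N k = (\<Prod>h=1..k. real (b h))" for k
  define S where "S k = (\<Sum>j<k. t j)" for k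
  have bpos: "real (b h) > 0" if "h \<ge> 1" for h using d[OF that] by simp
  have N: "N k > 0" for k unfolding N_def using bpos by (intro prod_pos) auto
  have NS: "N (Suc k) = N k * b (Suc k)" for k by (simp add: N_def)
  have t: "t k = d (Suc k) / N (Suc k)" for k
    by (simp add: t_def N_def prod_dividef)
  have value_eq: "S k = radix_value b d k / N k" for k
  proof (induction k)
    case 0 then show ?case by (simp add: S_def)
  next
    case (Suc k)
    have "S (Suc k) = S k + t k" by (simp add: S_def)
    with Suc show ?case using N[of k] bpos[of "Suc k"] by (simp add: t NS field_simps)
  qed
  have tnn: "t j \<ge> 0" for j using N[of "Suc j"] by (simp add: t)
  have "S k \<le> suminf t" unfolding S_def by (rule sum_le_suminf) (use sum tnn in auto)
  then show "radix_value b d k \<le> (\<Prod>h=1..k. real (b h)) * suminf t"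
    using N[of k] unfolding N_def[symmetric] value_eq by (simp add: field_simps)
  have "decseq (\<lambda>k. S k + 1 / N k)"
  proof (rule decseq_SucI)
    fix k
    have "real (d (Suc k)) + 1 \<le> b (Suc k)" using d[of "Suc k"] by simp
    then have "(real (d (Suc k)) + 1) / N (Suc k) \<le> b (Suc k) / N (Suc k)"
      using N[of "Suc k"] by (intro divide_right_mono) auto
    also have "\<dots> = 1 / N k" using bpos[of "Suc k"] by (simp add: NS)
    finally show "S (Suc k) + 1 / N (Suc k) \<le> S k + 1 / N k"
      by (simp add: S_def t add_divide_distrib)
  qed
  then have "S j \<le> S k + 1 / N k" if "j \<ge> k" for j
    using decseqD[of _ k j] that N[of j] by (smt (verit) divide_pos_pos)
  moreover have "S \<longlonglongrightarrow> suminf t" unfolding S_def using sum by (rule summable_LIMSEQ)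
  ultimately have "suminf t \<le> S k + 1 / N k" by (intro LIMSEQ_le_const2) auto
  then show "(\<Prod>h=1..k. real (b h)) * suminf t \<le> radix_value b d k + 1"
    using N[of k] unfolding N_def[symmetric] value_eq by (simp add: field_simps)
qed

text \<open>The integer parts of \<open>x\<close> at two comparable scales \<open>1 / \<alpha>\<close> and \<open>1 / \<beta>\<close> determine each
  other up to boundedly many choices.\<close>

lemma cell_index_range:
  fixes u v :: int and S :: nat and x \<alpha> \<beta> :: real
  assumes "\<alpha> > 0" "\<beta> > 0" "\<alpha> \<le> S * \<beta>"
    and u: "u \<le> \<alpha> * x" "\<alpha> * x \<le> u + 1" and v: "v \<le> \<beta> * x" "\<beta> * x \<le> v + 1"
  shows "u \<in> {\<lceil>\<alpha> / \<beta> * v\<rceil> - 1..\<lceil>\<alpha> / \<beta> * v\<rceil> + int S}"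
proof -
  \<comment> \<open>Rescaling by \<open>s\<close> turns the unit interval at \<open>v\<close> into
    one of length at most \<open>S\<close> at \<open>s * v\<close>; the extra unit below is the
    width of the interval at \<open>u\<close>.\<close>
  define s where "s = \<alpha> / \<beta>"
  have s: "s \<ge> 0" "s \<le> S" "\<alpha> * x = s * (\<beta> * x)" using assms(1-3) by (auto simp: s_def field_simps)
  have "s * v \<le> s * (\<beta> * x)" "s * (\<beta> * x) \<le> s * (v + 1)" using v s by (auto intro: mult_left_mono)
  then have "s * v \<le> u + 1" "u \<le> s * v + S" using u s by (auto simp: algebra_simps)
  then show ?thesis unfolding s_def[symmetric] by (auto, linarith+)
qed

text \<open>On \<open>T\<close> the map \<open>F\<close> is a function of \<open>c\<close>, obtained
  by choosing preimages with \<open>inv_into\<close>.\<close>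

lemma card_image_le_card_image:
  assumes "finite (c ` T)" "\<And>x y. x \<in> T \<Longrightarrow> y \<in> T \<Longrightarrow> c x = c y \<Longrightarrow> F x = F y"
  shows "card (F ` T) \<le> card (c ` T)"
proof -
  have "F x = F (inv_into T c (c x))" if "x \<in> T" for x
    by (rule assms(2)) (use that in \<open>auto simp: inv_into_into f_inv_into_f\<close>)
  then have "F ` T \<subseteq> (\<lambda>y. F (inv_into T c y)) ` c ` T" by auto
  then show ?thesis by (rule surj_card_le[OF assms(1)])
qed

section \<open>Comparison of the two partitions\<close>

locale moran =
  fixes n m :: "nat \<Rightarrow> nat" and D :: "nat \<Rightarrow> (nat \<times> nat) set"
    and p :: "nat \<Rightarrow> nat \<times> nat \<Rightarrow> real" and b :: nat
  assumes construction: "moran_construction n m D"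
    and probs: "p \<in> prob_vector_seqs D"
    and bound: "\<And>k. k \<ge> 1 \<Longrightarrow> n k \<le> b \<and> m k \<le> b"
begin

sublocale prob_space "word_measure D p"
  unfolding word_measure_def
  by (rule prob_space_PiM) (use prob_space_level[OF construction probs] in auto)

lemma base_ge_2: "k \<ge> 1 \<Longrightarrow> n k \<ge> 2" "k \<ge> 1 \<Longrightarrow> m k \<ge> 2"
  using construction by (auto simp: moran_construction_def)

lemma finite_level: "k \<ge> 1 \<Longrightarrow> finite (D k)"
  by (rule moran_construction_finite[OF construction])

lemma level_prob: "k \<ge> 1 \<Longrightarrow> w \<in> D k \<Longrightarrow> p k w \<ge> 0" "k \<ge> 1 \<Longrightarrow> (\<Sum>w\<in>D k. p k w) = 1"
  using probs by (auto simp: prob_vector_seqs_def prob_vectors_def)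

section \<open>Digits and coordinates of coded points\<close>

lemma infinite_wordsD:
  assumes "\<tau> \<in> infinite_words D" "h \<ge> 1"
  shows "\<tau> h \<in> D h" "fst (\<tau> h) < n h" "snd (\<tau> h) < m h"
proof -
  show *: "\<tau> h \<in> D h" using assms by (auto simp: infinite_words_def PiE_iff)
  have "D h \<subseteq> {0..<n h} \<times> {0..<m h}"
    using construction assms(2) by (auto simp: moran_construction_def)
  with * show "fst (\<tau> h) < n h" "snd (\<tau> h) < m h" by auto
qed

text \<open>The coordinates of the coding series are mixed radix expansions with digits
  \<open>fst \<circ> \<tau>\<close> and \<open>snd \<circ> \<tau>\<close>, because the projections
  are bounded linear and commute with the sum.\<close>

lemma coding_map_bounds:
  assumes "\<tau> \<in> infinite_words D"
  shows "radix_value n (fst \<circ> \<tau>) k \<le> (\<Prod>h=1..k. real (n h)) * fst (coding_map n m \<tau>)"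
    and "(\<Prod>h=1..k. real (n h)) * fst (coding_map n m \<tau>) \<le> radix_value n (fst \<circ> \<tau>) k + 1"
    and "radix_value m (snd \<circ> \<tau>) k \<le> (\<Prod>h=1..k. real (m h)) * snd (coding_map n m \<tau>)"
    and "(\<Prod>h=1..k. real (m h)) * snd (coding_map n m \<tau>) \<le> radix_value m (snd \<circ> \<tau>) k + 1"
proof -
  note sum = coding_map_summable[OF construction assms]
  have 1: "summable (\<lambda>k. (\<Prod>h=1..Suc k. 1 / real (n h)) * real ((fst \<circ> \<tau>) (Suc k)))"
    "fst (coding_map n m \<tau>)
      = (\<Sum>k. (\<Prod>h=1..Suc k. 1 / real (n h)) * real ((fst \<circ> \<tau>) (Suc k)))"
    using bounded_linear.summable[OF bounded_linear_fst sum]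
      bounded_linear.suminf[OF bounded_linear_fst sum]
    by (simp_all add: coding_map_def diag_map_def vec_of_def)
  have 2: "summable (\<lambda>k. (\<Prod>h=1..Suc k. 1 / real (m h)) * real ((snd \<circ> \<tau>) (Suc k)))"
    "snd (coding_map n m \<tau>)
      = (\<Sum>k. (\<Prod>h=1..Suc k. 1 / real (m h)) * real ((snd \<circ> \<tau>) (Suc k)))"
    using bounded_linear.summable[OF bounded_linear_snd sum]
      bounded_linear.suminf[OF bounded_linear_snd sum]
    by (simp_all add: coding_map_def diag_map_def vec_of_def)
  note lt = infinite_wordsD(2,3)[OF assms]
  show "radix_value n (fst \<circ> \<tau>) k \<le> (\<Prod>h=1..k. real (n h)) * fst (coding_map n m \<tau>)"
    "(\<Prod>h=1..k. real (n h)) * fst (coding_map n m \<tau>) \<le> radix_value n (fst \<circ> \<tau>) k + 1"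
    unfolding 1(2) by (rule radix_value_bounds[OF _ 1(1)]; use lt in simp)+
  show "radix_value m (snd \<circ> \<tau>) k \<le> (\<Prod>h=1..k. real (m h)) * snd (coding_map n m \<tau>)"
    "(\<Prod>h=1..k. real (m h)) * snd (coding_map n m \<tau>) \<le> radix_value m (snd \<circ> \<tau>) k + 1"
    unfolding 2(2) by (rule radix_value_bounds[OF _ 2(1)]; use lt in simp)+
qed

section \<open>The dyadic partition on the coding space\<close>

definition dyadic_index :: "nat \<Rightarrow> (nat \<Rightarrow> nat \<times> nat) \<Rightarrow> int \<times> int" where
  "dyadic_index t \<tau> = (\<lfloor>2 ^ t * fst (coding_map n m \<tau>)\<rfloor>, \<lfloor>2 ^ t * snd (coding_map n m \<tau>)\<rfloor>)"

text \<open>The value \<open>2 ^ t\<close> is included because a coded point may have a coordinate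
  equal to 1.\<close>

definition dyadic_range :: "nat \<Rightarrow> (int \<times> int) set" where
  "dyadic_range t = {0..2 ^ t} \<times> {0..2 ^ t}"

lemma finite_dyadic_range: "finite (dyadic_range t)"
  by (simp add: dyadic_range_def)

lemma dyadic_index_in_range:
  assumes "\<tau> \<in> infinite_words D"
  shows "dyadic_index t \<tau> \<in> dyadic_range t"
proof -
  have "\<lfloor>2 ^ t * x\<rfloor> \<in> {0..2 ^ t}" if "0 \<le> x" "x \<le> 1" for x :: real
  proof -
    have "2 ^ t * x \<le> 2 ^ t * 1" using that by (intro mult_left_mono) auto
    then have "\<lfloor>2 ^ t * x\<rfloor> \<le> \<lfloor>2 ^ t :: real\<rfloor>" by (intro floor_mono) simp
    also have "\<lfloor>2 ^ t :: real\<rfloor> = 2 ^ t" by (metis floor_of_int of_int_numeral of_int_power)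
    finally show ?thesis using that by simp
  qed
  \<comment> \<open>At level 0 the products are empty and the radix values are 0, so the bounds
    place both coordinates in [0, 1].\<close>
  then show ?thesis
    using coding_map_bounds[OF assms, of 0] by (auto simp: dyadic_index_def dyadic_range_def)
qed

lemma dyadic_index_measurable:
  "dyadic_index t -` {z} \<inter> space (word_measure D p) \<in> events"
proof -
  note coding = measurable_compose[OF coding_map_measurable[OF construction, of p]]
  have [measurable]: "(\<lambda>\<tau>. fst (coding_map n m \<tau>)) \<in> borel_measurable (word_measure D p)"
    "(\<lambda>\<tau>. snd (coding_map n m \<tau>)) \<in> borel_measurable (word_measure D p)"
    by (intro coding borel_measurable_continuous_onI continuous_intros)+
  have "dyadic_index t -` {z} \<inter> space (word_measure D p) =
    {\<tau>\<in>space (word_measure D p). \<lfloor>2 ^ t * fst (coding_map n m \<tau>)\<rfloor> = fst z \<and>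
      \<lfloor>2 ^ t * snd (coding_map n m \<tau>)\<rfloor> = snd z}"
    by (auto simp: dyadic_index_def)
  also have "\<dots> \<in> events" by measurable
  finally show ?thesis .
qed

text \<open>Forgotten digits become 0 instead of being dropped, so that every level carries a pair
  and one product formula covers both cases of the \<open>k\<close>th entropy.\<close>

definition approx_digits :: "nat \<Rightarrow> nat \<Rightarrow> nat \<times> nat \<Rightarrow> nat \<times> nat" where
  "approx_digits k h w =
     (if h \<le> approx_level n m k then fst w else 0, if h \<le> k then snd w else 0)"

text \<open>An arbitrary letterwise coarsening \<open>g\<close> keeps the independence argument
  apart from the shape of approximate squares. The restriction to \<open>{1..L}\<close> makes the
  words extensional, so they form a finite product set.\<close>

definition digit_word ::
    "(nat \<Rightarrow> nat \<times> nat \<Rightarrow> nat \<times> nat) \<Rightarrow> nat \<Rightarrow> (nat \<Rightarrow> nat \<times> nat) \<Rightarrow> nat \<Rightarrow> nat \<times> nat" where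
  "digit_word g L \<tau> = (\<lambda>h\<in>{1..L}. g h (\<tau> h))"

definition digit_words ::
    "(nat \<Rightarrow> nat \<times> nat \<Rightarrow> nat \<times> nat) \<Rightarrow> nat \<Rightarrow> (nat \<Rightarrow> nat \<times> nat) set" where
  "digit_words g L = (\<Pi>\<^sub>E h\<in>{1..L}. g h ` D h)"

lemma finite_digit_words: "finite (digit_words g L)"
  unfolding digit_words_def by (intro finite_PiE) (auto intro!: finite_level)

lemma digit_word_in_digit_words: "\<tau> \<in> infinite_words D \<Longrightarrow> digit_word g L \<tau> \<in> digit_words g L"
  by (auto simp: digit_word_def digit_words_def intro!: infinite_wordsD)

text \<open>The fibre constrains each level up to \<open>L\<close> separately, so its product
  measure factors.\<close>

lemma digit_word_fibre:
  assumes "y \<in> digit_words g L"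
  defines "F \<equiv> digit_word g L -` {y} \<inter> space (word_measure D p)"
  shows "F \<in> events" "prob F = (\<Prod>h=1..L. \<Sum>w | w \<in> D h \<and> g h w = y h. p h w)"
proof -
  let ?M = "\<lambda>k. point_measure (D k) (\<lambda>w. ennreal (p k w))"
  let ?X = "\<lambda>h. {w \<in> D h. g h w = y h}"
  have F: "F = prod_emb {1..} ?M {1..L} (\<Pi>\<^sub>E h\<in>{1..L}. ?X h)"
    unfolding F_def space_word_measure using assms(1)
    by (auto simp: prod_emb_def infinite_words_def space_point_measure PiE_iff restrict_def
      extensional_def digit_word_def digit_words_def fun_eq_iff)
  have X: "?X h \<in> sets (?M h)" for h by (auto simp: sets_point_measure)
  show "F \<in> events"
    unfolding F word_measure_def by (rule sets_PiM_I) (use X in auto)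
  have "emeasure (word_measure D p) F = (\<Prod>h\<in>{1..L}. emeasure (?M h) (?X h))"
    unfolding word_measure_def F
    by (rule emeasure_PiM_emb) (use prob_space_level[OF construction probs] X in auto)
  also have "\<dots> = (\<Prod>h\<in>{1..L}. ennreal (\<Sum>w | w \<in> D h \<and> g h w = y h. p h w))"
    by (rule prod.cong)
      (use finite_level level_prob in \<open>auto simp: emeasure_point_measure_finite2 intro!: sum_ennreal\<close>)
  also have "\<dots> = ennreal (\<Prod>h=1..L. \<Sum>w | w \<in> D h \<and> g h w = y h. p h w)"
    by (rule prod_ennreal) (use level_prob in \<open>auto intro!: sum_nonneg\<close>)
  finally show "prob F = (\<Prod>h=1..L. \<Sum>w | w \<in> D h \<and> g h w = y h. p h w)"
    by (rule measure_eq_emeasure_eq_ennreal[rotated])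
      (use level_prob in \<open>auto intro!: prod_nonneg sum_nonneg\<close>)
qed

text \<open>The coarse letters are independent, so \<open>entropy_PiE_prod\<close> adds their
  entropies. Each sum over coarse letters is regrouped over \<open>D h\<close> to match the form of
  the \<open>k\<close>th entropy.\<close>

lemma digit_word_entropy:
  "partition_entropy (word_measure D p) (digit_word g L) (digit_words g L) =
    - (\<Sum>h=1..L. \<Sum>w\<in>D h. p h w * ln (\<Sum>w' | w' \<in> D h \<and> g h w' = g h w. p h w'))"
proof -
  define r where "r h a = (\<Sum>w | w \<in> D h \<and> g h w = a. p h w)" for h a
  have regroup: "(\<Sum>a\<in>g h ` D h. r h a * f a) = (\<Sum>w\<in>D h. p h w * f (g h w))"
    if "h \<ge> 1" for h f
    unfolding r_def sum_distrib_right
    by (subst sum.image_gen[OF finite_level[OF that], of _ "g h"]) (auto intro!: sum.cong)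
  have "(\<Sum>y\<in>digit_words g L. (\<Prod>h=1..L. r h (y h)) * ln (\<Prod>h=1..L. r h (y h)))
      = (\<Sum>h=1..L. \<Sum>a\<in>g h ` D h. r h a * ln (r h a))"
    unfolding digit_words_def
  proof (rule entropy_PiE_prod)
    fix h assume h: "h \<in> {1..L}"
    show "(\<Sum>a\<in>g h ` D h. r h a) = 1"
      using regroup[of h "\<lambda>_. 1"] level_prob(2)[of h] h by simp
  qed (use finite_level level_prob in \<open>auto simp: r_def intro!: sum_nonneg\<close>)
  also have "\<dots> = (\<Sum>h=1..L. \<Sum>w\<in>D h. p h w * ln (r h (g h w)))"
    by (intro sum.cong refl regroup) auto
  finally show ?thesis
    unfolding partition_entropy_def by (simp add: digit_word_fibre r_def)
qed

abbreviation approx_word :: "nat \<Rightarrow> (nat \<Rightarrow> nat \<times> nat) \<Rightarrow> nat \<Rightarrow> nat \<times> nat" where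
  "approx_word k \<equiv> digit_word (approx_digits k) (max k (approx_level n m k))"

abbreviation approx_words :: "nat \<Rightarrow> (nat \<Rightarrow> nat \<times> nat) set" where
  "approx_words k \<equiv> digit_words (approx_digits k) (max k (approx_level n m k))"

text \<open>Up to level \<open>min k l\<close> both digits are kept and each class of letters is a
  singleton. Beyond it one digit survives: the vertical one if \<open>l < k\<close>, so classes are
  rows, and the horizontal one if \<open>k < l\<close>, so they are columns.\<close>

lemma approx_word_entropy:
  "partition_entropy (word_measure D p) (approx_word k) (approx_words k) = moran_entropy n m D p k"
proof -
  define l where "l = approx_level n m k"
  define e where "e h = (\<Sum>w\<in>D h. p h w *
    ln (\<Sum>w' | w' \<in> D h \<and> approx_digits k h w' = approx_digits k h w. p h w'))" for h
  have full: "e h = (\<Sum>w\<in>D h. p h w * ln (p h w))" if "h \<le> l" "h \<le> k" for h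
  proof -
    have "{w'. w' \<in> D h \<and> approx_digits k h w' = approx_digits k h w} = {w}" if "w \<in> D h" for w
      using \<open>h \<le> l\<close> \<open>h \<le> k\<close> that by (auto simp: approx_digits_def l_def prod_eq_iff)
    then show ?thesis unfolding e_def by (intro sum.cong) auto
  qed
  have row: "e h = (\<Sum>w\<in>D h. p h w * ln (row_prob D p h w))" if "l < h" "h \<le> k" for h
  proof -
    have "(\<Sum>w' | w' \<in> D h \<and> approx_digits k h w' = approx_digits k h w. p h w') = row_prob D p h w"
      for w
      unfolding row_prob_def
      by (rule sum.reindex_bij_witness[of _ "\<lambda>i. (i, snd w)" fst])
        (use that in \<open>auto simp: approx_digits_def l_def\<close>)
    then show ?thesis unfolding e_def by simp
  qed
  have column: "e h = (\<Sum>w\<in>D h. p h w * ln (column_prob D p h w))" if "k < h" "h \<le> l" for h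
  proof -
    have "(\<Sum>w' | w' \<in> D h \<and> approx_digits k h w' = approx_digits k h w. p h w') = column_prob D p h w"
      for w
      unfolding column_prob_def
      by (rule sum.reindex_bij_witness[of _ "\<lambda>j. (fst w, j)" snd])
        (use that in \<open>auto simp: approx_digits_def l_def\<close>)
    then show ?thesis unfolding e_def by simp
  qed
  have split: "(\<Sum>h=1..max k l. e h) = (\<Sum>h=1..min k l. e h) + (\<Sum>h=min k l + 1..max k l. e h)"
    using sum.ub_add_nat[of 1 "min k l" e "max k l - min k l"] by simp
  have "partition_entropy (word_measure D p) (approx_word k) (approx_words k) =
      - (\<Sum>h=1..max k l. e h)"
    unfolding digit_word_entropy e_def l_def ..
  also have "\<dots> = moran_entropy n m D p k"
  proof (cases "l \<le> k")
    case True
    have "(\<Sum>h=1..l. e h) = (\<Sum>h=1..l. \<Sum>w\<in>D h. p h w * ln (p h w))"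
      by (intro sum.cong full) (use True in auto)
    moreover have "(\<Sum>h=l+1..k. e h) = (\<Sum>h=l+1..k. \<Sum>w\<in>D h. p h w * ln (row_prob D p h w))"
      by (intro sum.cong row) (use True in auto)
    ultimately show ?thesis
      using True unfolding split by (simp add: moran_entropy_def l_def[symmetric] min_absorb2 max_absorb1)
  next
    case False
    have "(\<Sum>h=1..k. e h) = (\<Sum>h=1..k. \<Sum>w\<in>D h. p h w * ln (p h w))"
      by (intro sum.cong full) (use False in auto)
    moreover have "(\<Sum>h=k+1..l. e h) = (\<Sum>h=k+1..l. \<Sum>w\<in>D h. p h w * ln (column_prob D p h w))"
      by (intro sum.cong column) (use False in auto)
    ultimately show ?thesis
      using False unfolding split by (simp add: moran_entropy_def l_def[symmetric] min_absorb1 max_absorb2)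
  qed
  finally show ?thesis .
qed

section \<open>Approximate squares against dyadic boxes\<close>

lemma approx_level_bounds:
  assumes "k \<ge> 1"
  shows "(\<Prod>h=1..k. real (m h)) \<le> (\<Prod>h=1..approx_level n m k. real (n h))"
    and "(\<Prod>h=1..approx_level n m k. real (n h)) \<le> real b * (\<Prod>h=1..k. real (m h))"
proof -
  define l where "l = approx_level n m k"
  have "is_approx_level n m k l"
    unfolding l_def approx_level_def by (rule theI'[OF approx_level_ex1[OF construction assms]])
  then have l: "l \<ge> 1" "1 / (\<Prod>h=1..l. real (n h)) \<le> 1 / (\<Prod>h=1..k. real (m h))"
     "1 / (\<Prod>h=1..k. real (m h)) < 1 / (\<Prod>h=1..l-1. real (n h))"
    by (auto simp: is_approx_level_def)
  have pos: "(\<Prod>h=1..j. real (n h)) > 0" "(\<Prod>h=1..j. real (m h)) > 0" for j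
    using base_ge_2 by (fastforce intro!: prod_pos)+
  show "(\<Prod>h=1..k. real (m h)) \<le> (\<Prod>h=1..approx_level n m k. real (n h))"
    using l(2) pos(1)[of l] pos(2)[of k] unfolding l_def[symmetric] by (simp add: field_simps)
  \<comment> \<open>One factor fewer stays below the target, and the last factor \<open>n l\<close>
    is at most \<open>b\<close>.\<close>
  have "(\<Prod>h=1..l-1. real (n h)) \<le> (\<Prod>h=1..k. real (m h))"
    using l(3) pos(1)[of "l - 1"] pos(2)[of k] by (simp add: field_simps)
  moreover have "(\<Prod>h=1..l. real (n h)) = n l * (\<Prod>h=1..l-1. real (n h))"
    using l(1) by (cases l) auto
  ultimately show "(\<Prod>h=1..approx_level n m k. real (n h)) \<le> real b * (\<Prod>h=1..k. real (m h))"
    unfolding l_def[symmetric] using bound[OF l(1)] pos(1)[of "l - 1"]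
    by (simp add: mult_mono)
qed

text \<open>Uniqueness of expansions trades words for pairs of integers, to which
  \<open>cell_index_range\<close> applies.\<close>

lemma approx_word_eq_iff:
  assumes "\<tau> \<in> infinite_words D" "\<tau>' \<in> infinite_words D"
  shows "approx_word k \<tau> = approx_word k \<tau>' \<longleftrightarrow>
    radix_value n (fst \<circ> \<tau>) (approx_level n m k) = radix_value n (fst \<circ> \<tau>') (approx_level n m k) \<and>
    radix_value m (snd \<circ> \<tau>) k = radix_value m (snd \<circ> \<tau>') k" (is "?L \<longleftrightarrow> ?R")
proof
  assume L: ?L
  have *: "approx_digits k h (\<tau> h) = approx_digits k h (\<tau>' h)"
    if "1 \<le> h" "h \<le> max k (approx_level n m k)" for h
    using fun_cong[OF L, of h] that by (simp add: digit_word_def)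
  show ?R
  proof (intro conjI radix_value_cong)
    show "(fst \<circ> \<tau>) h = (fst \<circ> \<tau>') h" if "h \<in> {1..approx_level n m k}" for h
      using *[of h] that by (auto simp: approx_digits_def)
    show "(snd \<circ> \<tau>) h = (snd \<circ> \<tau>') h" if "h \<in> {1..k}" for h
      using *[of h] that by (auto simp: approx_digits_def)
  qed
next
  assume R: ?R
  have "fst (\<tau> h) = fst (\<tau>' h)" if "h \<in> {1..approx_level n m k}" for h
    using radix_value_inject[OF conjunct1[OF R] _ _ that] infinite_wordsD(2) assms by auto
  moreover have "snd (\<tau> h) = snd (\<tau>' h)" if "h \<in> {1..k}" for h
    using radix_value_inject[OF conjunct2[OF R] _ _ that] infinite_wordsD(3) assms by auto
  ultimately show ?L by (auto simp: digit_word_def approx_digits_def fun_eq_iff)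
qed

text \<open>Each dyadic box meets boundedly many approximate squares and conversely, so
  \<open>partition_entropy_le\<close> applies both ways. In each coordinate
  \<open>cell_index_range\<close> leaves \<open>b\<^sup>2 + 2\<close> integers; the outer square
  accounts for the two coordinates.\<close>

lemma entropy_comparison:
  assumes k: "k \<ge> 1" and t: "2 ^ t \<le> real b * (\<Prod>h=1..k. real (m h))" "(\<Prod>h=1..k. real (m h)) \<le> real b * 2 ^ t"
  shows "\<bar>partition_entropy (word_measure D p) (dyadic_index t) (dyadic_range t)
    - moran_entropy n m D p k\<bar> \<le> ln (real ((b\<^sup>2 + 2)\<^sup>2))"
proof -
  define l where "l = approx_level n m k"
  define N where "N = (\<Prod>h=1..l. real (n h))"
  define M where "M = (\<Prod>h=1..k. real (m h))"
  let ?\<Omega> = "space (word_measure D p)"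
  have N: "M \<le> N" "N \<le> real b * M"
    using approx_level_bounds[OF k] by (auto simp: N_def M_def l_def)
  have b: "b \<ge> 1" using bound[of 1] base_ge_2[of 1] by simp
  then have b2: "real b * x \<le> real (b\<^sup>2) * x" if "x \<ge> 0" for x :: real
    using that by (intro mult_right_mono) (auto simp: power2_eq_square)
  have pos: "N > 0" "M > 0"
    unfolding N_def M_def using base_ge_2 by (fastforce intro!: prod_pos)+
  \<comment> \<open>Both \<open>2 ^ t\<close> and \<open>N\<close> are within a factor
    \<open>b\<close> of \<open>M\<close>, hence within \<open>b\<^sup>2\<close> of each other. The
    vertical factor \<open>b\<close> is weakened to \<open>b\<^sup>2\<close> so that one window size
    serves both coordinates.\<close>
  have NM: "N \<le> real (b\<^sup>2) * 2 ^ t" "2 ^ t \<le> real (b\<^sup>2) * N"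
    "M \<le> real (b\<^sup>2) * 2 ^ t" "2 ^ t \<le> real (b\<^sup>2) * M"
  proof -
    have "real b * M \<le> real b * (real b * 2 ^ t)" "real b * M \<le> real b * N"
      using t(2) N(1) by (auto simp: M_def intro!: mult_left_mono)
    with N t(1) b2[of N] pos show "N \<le> real (b\<^sup>2) * 2 ^ t" "2 ^ t \<le> real (b\<^sup>2) * N"
      by (auto simp: power2_eq_square mult.assoc M_def)
    show "M \<le> real (b\<^sup>2) * 2 ^ t" "2 ^ t \<le> real (b\<^sup>2) * M"
      using order_trans[OF t(2) b2[of "2 ^ t"]] order_trans[OF t(1) b2] pos by (simp_all add: M_def)
  qed
  define cell where "cell \<tau> = (int (radix_value n (fst \<circ> \<tau>) l), int (radix_value m (snd \<circ> \<tau>) k))" for \<tau>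
  have cell_iff: "approx_word k \<tau> = approx_word k \<tau>' \<longleftrightarrow> cell \<tau> = cell \<tau>'"
    if "\<tau> \<in> ?\<Omega>" "\<tau>' \<in> ?\<Omega>" for \<tau> \<tau>'
    using approx_word_eq_iff[of \<tau> \<tau>' k] that by (simp add: cell_def l_def space_word_measure)
  define R where "R s a = {\<lceil>s * real_of_int a\<rceil> - 1..\<lceil>s * real_of_int a\<rceil> + int (b\<^sup>2)}" for s a
  have card_R: "card (R s a \<times> R s' a') = (b\<^sup>2 + 2)\<^sup>2" "finite (R s a \<times> R s' a')" for s s' a a'
  proof -
    have "card {x - 1..x + int (b\<^sup>2)} = b\<^sup>2 + 2" for x by (simp add: nat_eq_iff)
    then show "card (R s a \<times> R s' a') = (b\<^sup>2 + 2)\<^sup>2"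
      by (simp only: R_def card_cartesian_product power2_eq_square)
  qed (simp add: R_def)
  have bounds: "fst (cell \<tau>) \<in> R (N / 2 ^ t) (fst (dyadic_index t \<tau>))"
    "fst (dyadic_index t \<tau>) \<in> R (2 ^ t / N) (fst (cell \<tau>))"
    "snd (cell \<tau>) \<in> R (M / 2 ^ t) (snd (dyadic_index t \<tau>))"
    "snd (dyadic_index t \<tau>) \<in> R (2 ^ t / M) (snd (cell \<tau>))" if "\<tau> \<in> ?\<Omega>" for \<tau>
  proof -
    let ?x = "fst (coding_map n m \<tau>)" and ?y = "snd (coding_map n m \<tau>)"
    have "\<tau> \<in> infinite_words D" using that by (simp add: space_word_measure)
    note B = coding_map_bounds[OF this]
    have x: "fst (cell \<tau>) \<le> N * ?x" "N * ?x \<le> fst (cell \<tau>) + 1"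
      using B(1,2)[of l] by (simp_all add: cell_def N_def)
    have y: "snd (cell \<tau>) \<le> M * ?y" "M * ?y \<le> snd (cell \<tau>) + 1"
      using B(3,4)[of k] by (simp_all add: cell_def M_def)
    have d: "fst (dyadic_index t \<tau>) \<le> 2 ^ t * ?x" "2 ^ t * ?x \<le> fst (dyadic_index t \<tau>) + 1"
      "snd (dyadic_index t \<tau>) \<le> 2 ^ t * ?y" "2 ^ t * ?y \<le> snd (dyadic_index t \<tau>) + 1"
      unfolding dyadic_index_def fst_conv snd_conv
      by linarith+
    have tp: "(2::real) ^ t > 0" by simp
    show "fst (cell \<tau>) \<in> R (N / 2 ^ t) (fst (dyadic_index t \<tau>))"
      unfolding R_def by (rule cell_index_range[OF pos(1) tp NM(1) x d(1,2)])
    show "fst (dyadic_index t \<tau>) \<in> R (2 ^ t / N) (fst (cell \<tau>))"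
      unfolding R_def by (rule cell_index_range[OF tp pos(1) NM(2) d(1,2) x])
    show "snd (cell \<tau>) \<in> R (M / 2 ^ t) (snd (dyadic_index t \<tau>))"
      unfolding R_def by (rule cell_index_range[OF pos(2) tp NM(3) y d(3,4)])
    show "snd (dyadic_index t \<tau>) \<in> R (2 ^ t / M) (snd (cell \<tau>))"
      unfolding R_def by (rule cell_index_range[OF tp pos(2) NM(4) d(3,4) y])
  qed
  have card1: "card (approx_word k ` (dyadic_index t -` {z} \<inter> ?\<Omega>)) \<le> (b\<^sup>2 + 2)\<^sup>2" for z
  proof -
    let ?T = "dyadic_index t -` {z} \<inter> ?\<Omega>" and ?R = "R (N / 2 ^ t) (fst z) \<times> R (M / 2 ^ t) (snd z)"
    have "cell \<tau> \<in> ?R" if "\<tau> \<in> ?T" for \<tau>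
      using bounds(1,3)[of \<tau>] that by (simp add: mem_Times_iff)
    then have sub: "cell ` ?T \<subseteq> ?R" by (rule image_subsetI)
    have "card (approx_word k ` ?T) \<le> card (cell ` ?T)"
      by (rule card_image_le_card_image)
        (use cell_iff finite_subset[OF sub card_R(2)] in auto)
    also have "\<dots> \<le> (b\<^sup>2 + 2)\<^sup>2" using card_mono[OF card_R(2) sub] card_R(1) by simp
    finally show ?thesis .
  qed
  have card2: "card (dyadic_index t ` (approx_word k -` {y} \<inter> ?\<Omega>)) \<le> (b\<^sup>2 + 2)\<^sup>2" for y
  proof (cases "approx_word k -` {y} \<inter> ?\<Omega> = {}")
    case False
    then obtain \<tau>0 where \<tau>0: "\<tau>0 \<in> ?\<Omega>" "approx_word k \<tau>0 = y" by auto
    \<comment> \<open>All points of the fibre share the cell of \<open>\<tau>0\<close>, so one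
      window contains their dyadic indices.\<close>
    let ?R = "R (2 ^ t / N) (fst (cell \<tau>0)) \<times> R (2 ^ t / M) (snd (cell \<tau>0))"
    have "dyadic_index t \<tau> \<in> ?R" if "\<tau> \<in> ?\<Omega>" "approx_word k \<tau> = y" for \<tau>
      using bounds(2,4)[OF that(1)] cell_iff[of \<tau> \<tau>0] that \<tau>0 by (simp add: mem_Times_iff)
    then have "dyadic_index t ` (approx_word k -` {y} \<inter> ?\<Omega>) \<subseteq> ?R" by blast
    from card_mono[OF card_R(2) this] show ?thesis using card_R(1) by simp
  qed simp
  note facts = finite_digit_words finite_dyadic_range digit_word_in_digit_words dyadic_index_in_range
    digit_word_fibre(1) dyadic_index_measurable space_word_measure
  have "moran_entropy n m D p k
      \<le> partition_entropy (word_measure D p) (dyadic_index t) (dyadic_range t) + ln (real ((b\<^sup>2 + 2)\<^sup>2))"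
    unfolding approx_word_entropy[symmetric]
    by (rule partition_entropy_le[OF _ _ _ _ _ _ card1]) (use facts in auto)
  moreover have "partition_entropy (word_measure D p) (dyadic_index t) (dyadic_range t)
      \<le> moran_entropy n m D p k + ln (real ((b\<^sup>2 + 2)\<^sup>2))"
    unfolding approx_word_entropy[symmetric]
    by (rule partition_entropy_le[OF _ _ _ _ _ _ card2]) (use facts in auto)
  ultimately show ?thesis by linarith
qed

section \<open>The dyadic entropy of the Moran measure\<close>

text \<open>Boxes correspond to index pairs, and the coding map pulls a box back to a fibre of
  \<open>dyadic_index\<close>. Pairs outside \<open>dyadic_range\<close> have empty fibres and
  contribute 0, which makes the sum finite.\<close>

lemma dyadic_entropy_moran_measure:
  "dyadic_entropy (moran_measure n m D p) t =
    ereal (partition_entropy (word_measure D p) (dyadic_index t) (dyadic_range t))"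
proof -
  define box :: "int \<times> int \<Rightarrow> (real \<times> real) set" where
    "box z = {real_of_int (fst z) / 2 ^ t ..< (real_of_int (fst z) + 1) / 2 ^ t} \<times>
      {real_of_int (snd z) / 2 ^ t ..< (real_of_int (snd z) + 1) / 2 ^ t}" for z
  have boxes: "dyadic_boxes t = range box"
    unfolding dyadic_boxes_def by (auto simp: box_def[abs_def] full_SetCompr_eq[symmetric])
  have mem_box: "x \<in> box z \<longleftrightarrow> (\<lfloor>2 ^ t * fst x\<rfloor>, \<lfloor>2 ^ t * snd x\<rfloor>) = z" for x z
    by (cases x; cases z) (auto simp: box_def floor_eq_iff field_simps)
  have "inj box"
  proof (rule injI)
    fix z z' assume eq: "box z = box z'"
    \<comment> \<open>The lower left corner determines the index.\<close>
    have "(fst z / 2 ^ t, snd z / 2 ^ t) \<in> box z" by (simp add: mem_box)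
    moreover from this have "(fst z / 2 ^ t, snd z / 2 ^ t) \<in> box z'" unfolding eq .
    ultimately show "z = z'" unfolding mem_box by simp
  qed
  have "box z \<in> sets borel" for z
    unfolding box_def borel_prod[symmetric] by (intro pair_measureI) auto
  then have box: "measure (moran_measure n m D p) (box z)
      = prob (dyadic_index t -` {z} \<inter> space (word_measure D p))" for z
    unfolding moran_measure_def
    by (subst measure_distr[OF coding_map_measurable[OF construction]])
      (auto simp: mem_box dyadic_index_def intro!: arg_cong[of _ _ prob])
  have outside: "dyadic_index t -` {z} \<inter> space (word_measure D p) = {}" if "z \<notin> dyadic_range t" for z
    using that dyadic_index_in_range unfolding space_word_measure by blast
  define \<eta> where "\<eta> x = - (x * ln x)" for x :: real
  have "dyadic_entropy (moran_measure n m D p) t =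
      (\<Sum>\<^sub>\<infinity>z. ereal (\<eta> (measure (moran_measure n m D p) (box z))))"
    unfolding dyadic_entropy_def boxes \<eta>_def[symmetric]
    by (subst infsum_reindex[OF \<open>inj box\<close>]) (simp add: o_def)
  also have "\<dots> = (\<Sum>\<^sub>\<infinity>z\<in>dyadic_range t. ereal (\<eta> (measure (moran_measure n m D p) (box z))))"
    by (rule infsum_cong_neutral) (auto simp: box outside \<eta>_def)
  also have "\<dots> = ereal (\<Sum>z\<in>dyadic_range t. \<eta> (measure (moran_measure n m D p) (box z)))"
    by (simp add: finite_dyadic_range)
  finally show ?thesis
    by (simp add: box partition_entropy_def \<eta>_def sum_negf)
qed

section \<open>Normalised entropies\<close>

abbreviation dyadic_ratio :: "nat \<Rightarrow> real" where
  "dyadic_ratio t \<equiv>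
     partition_entropy (word_measure D p) (dyadic_index t) (dyadic_range t) / ln (2 ^ t)"

abbreviation moran_ratio :: "nat \<Rightarrow> real" where
  "moran_ratio k \<equiv> moran_entropy n m D p k / (\<Sum>i=1..k. ln (real (m i)))"

text \<open>A uniform bound on the ratio permits the change of denominator in
  \<open>ratio_comparison\<close>. The value 4 is crude: the \<open>(2 ^ t + 1)\<^sup>2\<close>
  index pairs number at most \<open>(2 ^ t) ^ 4\<close>.\<close>

lemma dyadic_ratio_bounds:
  assumes "t \<ge> 1"
  shows "dyadic_ratio t \<ge> 0" "dyadic_ratio t \<le> 4"
proof -
  have ln: "ln ((2::real) ^ t) > 0" using assms by (intro ln_gt_zero one_less_power) auto
  then show "dyadic_ratio t \<ge> 0" by (intro divide_nonneg_pos partition_entropy_nonneg)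
  have "(2::real) \<le> 2 ^ t" using power_increasing[OF assms, of "2::real"] by simp
  then have "2 ^ t + 1 \<le> (2::real) ^ t * 2 ^ t"
    using mult_right_mono[of 2 "(2::real) ^ t" "2 ^ t"] by linarith
  then have le: "((2::real) ^ t + 1)\<^sup>2 \<le> (2 ^ t) ^ 4"
    using power_mono[of "(2::real) ^ t + 1" "2 ^ t * 2 ^ t" 2] by (simp add: power2_eq_square eval_nat_numeral)
  have card: "real (card (dyadic_range t)) = (2 ^ t + 1)\<^sup>2"
  proof -
    have "real (card {0..2 ^ t :: int}) = 2 ^ t + 1" by (simp add: nat_add_distrib nat_power_eq)
    then show ?thesis
      by (simp only: dyadic_range_def card_cartesian_product power2_eq_square of_nat_mult)
  qed
  have "partition_entropy (word_measure D p) (dyadic_index t) (dyadic_range t)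
      \<le> ln (card (dyadic_range t))"
    by (rule partition_entropy_le_ln_card)
      (use finite_dyadic_range dyadic_index_in_range dyadic_index_measurable space_word_measure in auto)
  also have "\<dots> \<le> ln ((2 ^ t) ^ 4)" unfolding card using le by (intro ln_mono zero_less_power add_pos_pos) auto
  also have "\<dots> = 4 * ln (2 ^ t)" by (simp add: ln_realpow)
  finally show "dyadic_ratio t \<le> 4" using ln by (simp add: divide_le_eq)
qed

text \<open>The numerators differ by a constant and the denominators by at most \<open>ln b\<close>,
  while the Moran denominator is at least \<open>j * ln 2\<close>. The free index \<open>j\<close>
  lets the decay be read along \<open>k\<close> or along \<open>t\<close>.\<close>

lemma ratio_comparison:
  assumes kt: "k \<ge> 1" "t \<ge> 1"
    and comparable: "2 ^ t \<le> real b * (\<Prod>h=1..k. real (m h))" "(\<Prod>h=1..k. real (m h)) \<le> real b * 2 ^ t"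
    and j: "j \<ge> 1" "2 ^ j \<le> (\<Prod>h=1..k. real (m h))"
  shows "\<bar>moran_ratio k - dyadic_ratio t\<bar> \<le> (4 * ln b + ln (real ((b\<^sup>2 + 2)\<^sup>2))) / ln 2 / j"
proof -
  define M where "M = (\<Prod>h=1..k. real (m h))"
  define x where "x = ln ((2::real) ^ t)"
  define y where "y = (\<Sum>i=1..k. ln (real (m i)))"
  define g where "g = partition_entropy (word_measure D p) (dyadic_index t) (dyadic_range t)"
  define H where "H = moran_entropy n m D p k"
  define c where "c = ln (real ((b\<^sup>2 + 2)\<^sup>2))"
  have mpos: "real (m i) > 0" if "i \<ge> 1" for i using base_ge_2(2)[OF that] by simp
  have b: "b \<ge> 2" using bound[of 1] base_ge_2[of 1] by simp
  have M: "M > 0" unfolding M_def using mpos by (intro prod_pos) auto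
  have y: "y = ln M" unfolding y_def M_def using mpos by (subst ln_prod) fastforce+
  have x: "x > 0" unfolding x_def using kt(2) by (intro ln_gt_zero one_less_power) auto
  have "ln (2 ^ j) \<le> ln M" using j M unfolding M_def by (intro ln_mono) auto
  then have jy: "j * ln 2 \<le> y" by (simp add: y ln_realpow)
  moreover have "j * ln 2 > 0" using j(1) by simp
  ultimately have ypos: "y > 0" by linarith
  have "ln (2 ^ t) \<le> ln (b * M)" "ln M \<le> ln (b * 2 ^ t)"
    using comparable M b unfolding M_def[symmetric] by (auto intro!: ln_mono)
  then have xy: "\<bar>y - x\<bar> \<le> ln b" using b M unfolding x_def y by (simp add: ln_mult)
  have gH: "\<bar>g - H\<bar> \<le> c"
    unfolding g_def H_def c_def by (rule entropy_comparison[OF kt(1) comparable])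
  \<comment> \<open>The error splits into the change of numerator and the change of denominator, the
    latter weighted by the bounded ratio \<open>g / x\<close>.\<close>
  have "\<bar>H / y - g / x\<bar> * y = \<bar>(H - g) + (g / x) * (x - y)\<bar>"
    using x ypos by (simp add: abs_mult_pos[symmetric] field_simps)
  also have "\<dots> \<le> \<bar>g - H\<bar> + \<bar>g / x\<bar> * \<bar>y - x\<bar>"
    by (rule order_trans[OF abs_triangle_ineq]) (simp add: abs_mult abs_minus_commute)
  also have "\<dots> \<le> c + 4 * ln b"
    using dyadic_ratio_bounds[OF kt(2)] xy gH unfolding x_def[symmetric] g_def[symmetric]
    by (intro add_mono mult_mono) auto
  finally have "\<bar>H / y - g / x\<bar> \<le> (4 * ln b + c) / y" using ypos by (simp add: field_simps)
  also have "\<dots> \<le> (4 * ln b + c) / (j * ln 2)"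
    using jy \<open>j * ln 2 > 0\<close> b gH ypos by (intro divide_left_mono) auto
  finally show ?thesis unfolding H_def y_def g_def x_def c_def by (simp add: mult.commute)
qed

end

section \<open>Transfer of limits\<close>

text \<open>The reparametrisation \<open>f\<close> may skip indices, so each limit is bounded on one
  side only; a second application with the roles exchanged gives equality.\<close>

lemma limsup_liminf_transfer:
  fixes a b :: "nat \<Rightarrow> real"
  assumes f: "filterlim f at_top sequentially"
    and close: "(\<lambda>k. b k - a (f k)) \<longlonglongrightarrow> 0"
  shows "limsup (\<lambda>k. ereal (b k)) \<le> limsup (\<lambda>t. ereal (a t))"
    and "liminf (\<lambda>t. ereal (a t)) \<le> liminf (\<lambda>k. ereal (b k))"
proof -
  have lim: "(\<lambda>k. ereal (b k - a (f k))) \<longlonglongrightarrow> 0"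
    using close by (simp add: zero_ereal_def)
  have eq: "(\<lambda>k. ereal (b k)) = (\<lambda>k. ereal (b k - a (f k)) + ereal (a (f k)))" by simp
  have "limsup (\<lambda>k. ereal (b k)) = limsup (\<lambda>k. ereal (a (f k)))"
    unfolding eq using ereal_limsup_lim_add[OF lim, of "\<lambda>k. ereal (a (f k))"] by simp
  also have "\<dots> \<le> limsup (\<lambda>t. ereal (a t))"
    unfolding Limsup_le_iff
  proof (intro allI impI)
    fix y assume "limsup (\<lambda>t. ereal (a t)) < y"
    then show "\<forall>\<^sub>F k in sequentially. ereal (a (f k)) < y"
      by (rule eventually_compose_filterlim[OF Limsup_lessD f])
  qed
  finally show "limsup (\<lambda>k. ereal (b k)) \<le> limsup (\<lambda>t. ereal (a t))" .
  have "liminf (\<lambda>t. ereal (a t)) \<le> liminf (\<lambda>k. ereal (a (f k)))"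
    unfolding le_Liminf_iff
  proof (intro allI impI)
    fix y assume "y < liminf (\<lambda>t. ereal (a t))"
    then show "\<forall>\<^sub>F k in sequentially. y < ereal (a (f k))"
      by (rule eventually_compose_filterlim[OF less_LiminfD f])
  qed
  also have "\<dots> = liminf (\<lambda>k. ereal (b k))"
    unfolding eq using ereal_liminf_lim_add[OF lim, of "\<lambda>k. ereal (a (f k))"] by simp
  finally show "liminf (\<lambda>t. ereal (a t)) \<le> liminf (\<lambda>k. ereal (b k))" .
qed

context moran
begin

section \<open>Matching of vertical and dyadic scales\<close>

lemma prod_m_bounds: "2 ^ k \<le> (\<Prod>h=1..k. m h)" "(\<Prod>h=1..k. m h) \<le> b ^ k"
  using prod_mono[of "{1..k}" "\<lambda>_. 2" m] prod_mono[of "{1..k}" m "\<lambda>_. b"] base_ge_2(2) bound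
  by auto

lemma ex_dyadic_level:
  assumes "k \<ge> 1"
  shows "\<exists>t\<ge>k. 2 ^ t \<le> real b * (\<Prod>h=1..k. real (m h)) \<and> (\<Prod>h=1..k. real (m h)) \<le> real b * 2 ^ t"
proof -
  define M where "M = (\<Prod>h=1..k. m h)"
  have b: "b \<ge> 2" using bound[of 1] base_ge_2[of 1] by simp
  have Mk: "2 ^ k \<le> M" unfolding M_def by (rule prod_m_bounds)
  then have "M \<ge> 1" using order_trans[OF one_le_power[of "2::nat" k] Mk] by simp
  \<comment> \<open>\<open>t\<close> is the integer part of the binary logarithm of
    \<open>M\<close>; the factor 2 in the upper bound is absorbed by
    \<open>b \<ge> 2\<close>.\<close>
  then obtain t where t: "2 ^ t \<le> M" "M < 2 ^ (t + 1)" using ex_power_ivl1[of 2 M] by auto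
  have "(2::nat) ^ k < 2 ^ (t + 1)" using Mk t by linarith
  then have "k < t + 1" by (rule power_less_imp_less_exp[rotated]) simp
  then have "k \<le> t" by simp
  moreover have "2 ^ t \<le> b * M" using t(1) b mult_le_mono[of 1 b "2 ^ t" M] by simp
  moreover have "M \<le> b * 2 ^ t" using t(2) mult_le_mono1[OF b, of "2 ^ t"] by (simp, linarith)
  ultimately have "k \<le> t" "real (2 ^ t) \<le> real (b * M)" "real M \<le> real (b * 2 ^ t)"
    by (simp_all only: of_nat_le_iff)
  then show ?thesis by (intro exI[of _ t]) (simp add: M_def)
qed

text \<open>The least \<open>k\<close> whose product reaches \<open>2 ^ t\<close> overshoots by at
  most its last factor. The bound \<open>t \<le> b * k\<close> makes \<open>k\<close> tend to
  infinity with \<open>t\<close>.\<close>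

lemma ex_moran_level:
  assumes "t \<ge> 1"
  shows "\<exists>k\<ge>1. t \<le> b * k \<and> 2 ^ t \<le> (\<Prod>h=1..k. real (m h)) \<and> (\<Prod>h=1..k. real (m h)) \<le> real b * 2 ^ t"
proof -
  define M where "M k = (\<Prod>h=1..k. m h)" for k
  define k where "k = (LEAST k. 2 ^ t \<le> M k)"
  have k: "2 ^ t \<le> M k"
    unfolding k_def by (rule LeastI[of _ t], unfold M_def, rule prod_m_bounds)
  have "(2::nat) ^ t > 1" using assms by (intro one_less_power) auto
  with k have k1: "k \<ge> 1" by (cases k) (auto simp: M_def)
  then have "M (k - 1) < 2 ^ t" using not_less_Least[of "k - 1" "\<lambda>k. 2 ^ t \<le> M k"]
    unfolding k_def[symmetric] by simp
  moreover have "M k = m k * M (k - 1)" using k1 by (cases k) (auto simp: M_def)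
  ultimately have "M k \<le> b * 2 ^ t" using bound[OF k1] by (simp add: mult_le_mono)
  moreover have "t \<le> b * k"
  proof -
    have "b ^ k \<le> (2 ^ b) ^ k" by (intro power_mono) (auto intro: less_imp_le less_exp)
    with k prod_m_bounds(2)[of k] have "2 ^ t \<le> (2::nat) ^ (b * k)"
      by (simp add: M_def power_mult)
    then show ?thesis by simp
  qed
  ultimately have "t \<le> b * k" "real (2 ^ t) \<le> real (M k)" "real (M k) \<le> real (b * 2 ^ t)"
    using k by (simp_all only: of_nat_le_iff)
  with k1 show ?thesis by (intro exI[of _ k]) (simp add: M_def)
qed

lemma limsup_liminf_ratio:
  "limsup (\<lambda>t. ereal (dyadic_ratio t)) = limsup (\<lambda>k. ereal (moran_ratio k))"
  "liminf (\<lambda>t. ereal (dyadic_ratio t)) = liminf (\<lambda>k. ereal (moran_ratio k))"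
proof -
  define c where "c = (4 * ln b + ln (real ((b\<^sup>2 + 2)\<^sup>2))) / ln 2"
  have b: "b \<ge> 2" using bound[of 1] base_ge_2[of 1] by simp
  have c: "(\<lambda>j. c / real j) \<longlonglongrightarrow> 0" by (rule lim_const_over_n)
  obtain f where f: "f k \<ge> k" "2 ^ f k \<le> real b * (\<Prod>h=1..k. real (m h))"
    "(\<Prod>h=1..k. real (m h)) \<le> real b * 2 ^ f k" if "k \<ge> 1" for k
    using ex_dyadic_level by metis
  obtain g where g: "g t \<ge> 1" "t \<le> b * g t" "2 ^ t \<le> (\<Prod>h=1..g t. real (m h))"
    "(\<Prod>h=1..g t. real (m h)) \<le> real b * 2 ^ t" if "t \<ge> 1" for t
    using ex_moran_level by metis
  have 1: "filterlim f at_top sequentially"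
    by (rule filterlim_at_top_mono[OF filterlim_ident])
      (use f in \<open>auto intro: eventually_sequentiallyI[of 1]\<close>)
  have 2: "filterlim g at_top sequentially"
    unfolding filterlim_at_top
  proof
    fix Z
    show "\<forall>\<^sub>F t in sequentially. Z \<le> g t"
    proof (rule eventually_sequentiallyI[of "max 1 (b * Z)"])
      fix t assume "max 1 (b * Z) \<le> t"
      then have "b * Z \<le> b * g t" using g(2)[of t] by linarith
      then show "Z \<le> g t" using b by simp
    qed
  qed
  \<comment> \<open>Here \<open>ratio_comparison\<close> is used with \<open>j = k\<close>, and in
    the reverse direction with \<open>j = t\<close>, the index that tends to infinity in each
    case.\<close>
  have "(\<lambda>k. moran_ratio k - dyadic_ratio (f k)) \<longlonglongrightarrow> 0"
  proof (rule Lim_null_comparison[OF _ c], rule eventually_sequentiallyI)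
    fix k :: nat assume k: "1 \<le> k"
    have "(2::real) ^ k \<le> (\<Prod>h=1..k. real (m h))"
      using of_nat_mono[OF prod_m_bounds(1)[of k], where 'a = real] by simp
    then show "norm (moran_ratio k - dyadic_ratio (f k)) \<le> c / real k"
      unfolding c_def real_norm_def using f[OF k] k by (intro ratio_comparison) auto
  qed
  note 3 = limsup_liminf_transfer[OF 1 this]
  have "(\<lambda>t. dyadic_ratio t - moran_ratio (g t)) \<longlonglongrightarrow> 0"
  proof (rule Lim_null_comparison[OF _ c], rule eventually_sequentiallyI)
    fix t :: nat assume t: "1 \<le> t"
    have "2 ^ t \<le> real b * (\<Prod>h=1..g t. real (m h))"
      using g(3)[OF t] b mult_mono[of 1 "real b" "2 ^ t" "\<Prod>h=1..g t. real (m h)"] by simp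
    then show "norm (dyadic_ratio t - moran_ratio (g t)) \<le> c / real t"
      unfolding c_def real_norm_def using g[OF t] t
      by (subst abs_minus_commute, intro ratio_comparison) auto
  qed
  note 4 = limsup_liminf_transfer[OF 2 this]
  from 3 4 show "limsup (\<lambda>t. ereal (dyadic_ratio t)) = limsup (\<lambda>k. ereal (moran_ratio k))"
    "liminf (\<lambda>t. ereal (dyadic_ratio t)) = liminf (\<lambda>k. ereal (moran_ratio k))"
    by (auto intro: antisym)
qed

end

theorem theorem2p1:
  fixes n m :: "nat \<Rightarrow> nat"
    and D :: "nat \<Rightarrow> (nat \<times> nat) set"
    and E :: "(real \<times> real) set"
    and p :: "nat \<Rightarrow> nat \<times> nat \<Rightarrow> real"
  assumes "moran_construction n m D"
    and "E = moran_set n m D"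
    and "bdd_above (n ` {1..} \<union> m ` {1..})"
    and "p \<in> prob_vector_seqs D"
  shows "upper_entropy_dim (moran_measure n m D p) =
           limsup (\<lambda>k. ereal (moran_entropy n m D p k / (\<Sum>i=1..k. ln (real (m i))))) \<and>
         lower_entropy_dim (moran_measure n m D p) =
           liminf (\<lambda>k. ereal (moran_entropy n m D p k / (\<Sum>i=1..k. ln (real (m i)))))"
proof -
  obtain b where "\<And>x. x \<in> n ` {1..} \<union> m ` {1..} \<Longrightarrow> x \<le> b"
    using assms(3) unfolding bdd_above_def by blast
  then interpret moran n m D p b
    using assms by unfold_locales auto
  \<comment> \<open>Level 0 is excluded: there the denominator is 0, and division by zero follows
    different conventions in \<open>ereal\<close> and \<open>real\<close>.\<close>
  have ratio: "\<forall>\<^sub>F t in sequentially.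
      dyadic_entropy (moran_measure n m D p) t / ereal (ln (2 ^ t)) = ereal (dyadic_ratio t)"
    by (rule eventually_sequentiallyI[of 1]) (simp add: dyadic_entropy_moran_measure ln_realpow)
  show ?thesis
    unfolding upper_entropy_dim_def lower_entropy_dim_def
      Limsup_eq[OF ratio] Liminf_eq[OF ratio] limsup_liminf_ratio by simp
qed

end
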